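(* Define the set-valued map $\Phi:PH\to 2^{QH}$ by $\Phi(p_0)=\{q_0\in QH:(p_0,q_0)\in\mathcal M_{-\infty}\}$. Then $\Phi(p_0)$ is nonempty for every $p_0\in PH$, $\Phi$ is upper hemicontinuous, and $\mathcal M_{-\infty}=\{(p_0,q_0):p_0\in PH,\ q_0\in\Phi(p_0)\}$ is the graph of $\Phi$. Moreover $\mathcal M_{-\infty}$ is invariant under the solution semigroup $S(t)$ of $u_t+Au=F(u)$ (i.e. $S(t)\mathcal M_{-\infty}=\mathcal M_{-\infty}$ for all $t\ge 0$) and contains the global attractor of this equation.
   Context: Standing assumptions: $H$ is a real Hilbert space with norm $|\cdot|$. $A$ is a linear, closed, unbounded, positive self-adjoint operator on $H$ with compact inverse, so $H$ has an orthonormal basis of eigenvectors of $A$ with eigenvalues $0<\lambda_1<\lambda_2\le\cdots\le\lambda_N<\lambda_{N+1}\le\cdots\to\infty$ (counted with multiplicity). $F:H\to H$ satisfies $|F(u)|\le K_0$ and $|F(u)-F(v)|\le K_1|u-v|$ for all $u,v\in H$, with constants $K_0,K_1>0$ and $K_1<\lambda_{N+1}$; moreover there is $R>0$ with $F(u)=0$ whenever $|u|\ge R$. $P$ is the orthogonal (spectral) projection onto the span of the first $N$ eigenvectors of $A$, and $Q=I-P$; points of $H$ are identified with pairs $(p,q)\in PH\times QH$. A solution on an interval $J$ means a continuous function satisfying the variation of constants formula $u(t)=e^{-A(t-s)}u(s)+\int_s^t e^{-A(t-\tau)}F(u(\tau))\,d\tau$ for all $s\le t$ in $J$; $S(t)u_0$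 denotes the value at time $t$ of the solution on $[0,\infty)$ starting at $u_0$. $\mathcal M_{-\infty}$ is the set of all $(p_0,q_0)\in H$ such that there is a solution $u(t)=p(t)+q(t)$ of $u_t+Au=F(u)$ on $(-\infty,0]$ with $p(0)=p_0$, $q(0)=q_0$ and $q(t)=Qu(t)$ bounded on $(-\infty,0]$ (the backward bounded solutions). A set-valued map $\Phi:PH\to 2^{QH}$ is upper hemicontinuous if for every $p\in PH$ and every open set $U\supset\Phi(p)$ there is a neighbourhood $V$ of $p$ with $\Phi(p')\subset U$ for all $p'\in V$. The global attractor is the maximal compact invariant set of $S(t)$ that attracts all bounded sets. *)

theory Defs
  imports "HOL-Analysis.Analysis"
begin

text \<open>The operator A is encoded by its spectral data: a complete orthonormal
system e of eigenvectors with eigenvalues lam (index 0 corresponds to lambda_1).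
The analytic semigroup exp(-At) acts diagonally.\<close>

definition expA :: "(nat \<Rightarrow> 'a::real_inner) \<Rightarrow> (nat \<Rightarrow> real) \<Rightarrow> real \<Rightarrow> 'a \<Rightarrow> 'a" where
  "expA e lam t u = (\<Sum>n. exp (- lam n * t) *\<^sub>R ((u \<bullet> e n) *\<^sub>R e n))"

definition Pproj :: "(nat \<Rightarrow> 'a::real_inner) \<Rightarrow> nat \<Rightarrow> 'a \<Rightarrow> 'a" where
  "Pproj e N u = (\<Sum>n<N. (u \<bullet> e n) *\<^sub>R e n)"

definition Qproj :: "(nat \<Rightarrow> 'a::real_inner) \<Rightarrow> nat \<Rightarrow> 'a \<Rightarrow> 'a" where
  "Qproj e N u = u - Pproj e N u"

text \<open>Mild solution on J: continuous and satisfying the variation of constants formula.\<close>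
definition is_solution ::
  "(nat \<Rightarrow> 'a::real_inner) \<Rightarrow> (nat \<Rightarrow> real) \<Rightarrow> ('a \<Rightarrow> 'a) \<Rightarrow> real set \<Rightarrow> (real \<Rightarrow> 'a) \<Rightarrow> bool" where
  "is_solution e lam F J u \<longleftrightarrow> continuous_on J u \<and>
     (\<forall>s\<in>J. \<forall>t\<in>J. s \<le> t \<longrightarrow>
        ((\<lambda>\<tau>. expA e lam (t - \<tau>) (F (u \<tau>))) has_integral (u t - expA e lam (t - s) (u s))) {s..t})"

definition flow ::
  "(nat \<Rightarrow> 'a::real_inner) \<Rightarrow> (nat \<Rightarrow> real) \<Rightarrow> ('a \<Rightarrow> 'a) \<Rightarrow> real \<Rightarrow> 'a \<Rightarrow> 'a" where
  "flow e lam F t u0 = (THE v. \<exists>u. is_solution e lam F {0..} u \<and> u 0 = u0 \<and> u t = v)"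

definition Mminf ::
  "(nat \<Rightarrow> 'a::real_inner) \<Rightarrow> (nat \<Rightarrow> real) \<Rightarrow> nat \<Rightarrow> ('a \<Rightarrow> 'a) \<Rightarrow> 'a set" where
  "Mminf e lam N F = {u0. \<exists>u. is_solution e lam F {..0} u \<and> u 0 = u0 \<and>
       bounded ((\<lambda>t. Qproj e N (u t)) ` {..0})}"

definition Phi ::
  "(nat \<Rightarrow> 'a::real_inner) \<Rightarrow> (nat \<Rightarrow> real) \<Rightarrow> nat \<Rightarrow> ('a \<Rightarrow> 'a) \<Rightarrow> 'a \<Rightarrow> 'a set" where
  "Phi e lam N F p0 = {q0 \<in> range (Qproj e N). p0 + q0 \<in> Mminf e lam N F}"

text \<open>Upper hemicontinuity of a set-valued map defined on the subspace D.
(Open sets in H are used; since all values lie in QH and neighbourhoods are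
intersected with D = PH, this is the same as using relatively open sets.)\<close>
definition upper_hemicontinuous_on :: "'a::topological_space set \<Rightarrow> ('a \<Rightarrow> 'b::topological_space set) \<Rightarrow> bool" where
  "upper_hemicontinuous_on D \<Phi> \<longleftrightarrow>
     (\<forall>p\<in>D. \<forall>U. open U \<and> \<Phi> p \<subseteq> U \<longrightarrow>
        (\<exists>V. open V \<and> p \<in> V \<and> (\<forall>p'\<in>V \<inter> D. \<Phi> p' \<subseteq> U)))"

definition global_attractor :: "(real \<Rightarrow> 'a::metric_space \<Rightarrow> 'a) \<Rightarrow> 'a set \<Rightarrow> bool" where
  "global_attractor S \<A> \<longleftrightarrow>
     compact \<A> \<and> \<A> \<noteq> {} \<and>
     (\<forall>t\<ge>0. S t ` \<A> = \<A>) \<and>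
     (\<forall>B. bounded B \<longrightarrow>
        (\<forall>\<epsilon>>0. \<exists>T. \<forall>t\<ge>T. \<forall>b\<in>B. infdist (S t b) \<A> < \<epsilon>)) \<and>
     (\<forall>K. compact K \<and> (\<forall>t\<ge>0. S t ` K = K) \<longrightarrow> K \<subseteq> \<A>)"

end

theory Submission
  imports Defs
begin

text \<open>Because \<open>F\<close> is bounded, the component \<open>Q\<^sub>M u(t)\<close> (orthogonal to the first \<open>M\<close> eigenvectors)
  of a backward solution with bounded \<open>Q\<close>-part has norm at most \<open>K0 / lam M\<close>, while the \<open>P\<close>-part
  grows at most exponentially backward in time. The states at each time \<open>-n\<close> thus range over a
  compact set, and by Tychonoff's theorem limits of backward orbits are backward orbits; this gives
  upper hemicontinuity. For nonemptiness, start at time \<open>-T\<close> on \<open>PH\<close>: the map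
  \<open>p \<mapsto> P S(T) p\<close> is a bounded perturbation of the invertible map \<open>exp(-AT)\<close>, so by a
  finite-dimensional fixed point argument it comes arbitrarily close to any prescribed \<open>p\<^sub>0\<close>; let
  \<open>T\<close> tend to infinity.\<close>

section \<open>Sequences in products of compact sets\<close>

text \<open>Compactness has two obstacles, infinitely many modes and an unbounded past. For the
  first, the tail bound holds for every \<open>M \<ge> N\<close> and not only for
  \<open>M = N\<close>: \<open>lam M\<close> tends to infinity, so the tails are uniformly small,
  and the bound does not involve the bound of the individual orbit. For the second, orbits are
  sampled at integer times. An orbit is then one point of a countable product, and being an orbit is
  the condition \<open>S 1 (a (Suc n)) = a n\<close>, which survives coordinatewise limits because
  \<open>S 1\<close> is continuous; the flow restores the solution between samples. Orbits started
  on \<open>PH\<close> have no initial \<open>Q\<close>-part, so they obey the same tail bounds as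
  genuine backward orbits. Hitting \<open>p0\<close> approximately is enough, since the error can
  vanish along the same limit that moves the starting time to minus infinity.\<close>

lemma compact_PiE_UNIV:
  fixes K :: "'i \<Rightarrow> 'b::topological_space set"
  assumes "\<And>i. compact (K i)"
  shows "compact (Pi\<^sub>E UNIV K)"
  using assms by (simp add: compactin_PiE flip: euclidean_product_topology compactin_euclidean_iff)

lemma tendsto_coordinate:
  fixes x :: "nat \<Rightarrow> 'i \<Rightarrow> 'b::topological_space"
  assumes "x \<longlonglongrightarrow> l"
  shows "(\<lambda>k. x k i) \<longlonglongrightarrow> l i"
  using continuous_on_tendsto_compose[OF continuous_on_product_coordinates assms] by simp

text \<open>The countable index set makes the product topology first countable, so compactness of
  the product yields one subsequence serving all coordinates. This takes the place of a diagonal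
  argument.\<close>

lemma compact_sequences_coordinatewise:
  fixes x :: "nat \<Rightarrow> nat \<Rightarrow> 'b::metric_space"
  assumes "\<And>n. compact (K n)" "\<And>k n. x k n \<in> K n"
  obtains l r where "strict_mono r" "\<And>n. (\<lambda>k. x (r k) n) \<longlonglongrightarrow> l n" "\<And>n. l n \<in> K n"
proof -
  have "seq_compact (Pi\<^sub>E UNIV K)"
    using compact_PiE_UNIV[of K] assms(1) compact_imp_seq_compact by blast
  moreover have "\<forall>k. x k \<in> Pi\<^sub>E UNIV K"
    using assms(2) by auto
  ultimately obtain l r where "l \<in> Pi\<^sub>E UNIV K" "strict_mono r" "(x \<circ> r) \<longlonglongrightarrow> l"
    unfolding seq_compact_def by metis
  then show ?thesis
    using tendsto_coordinate[of "x \<circ> r" l] by (intro that[of r l]) auto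
qed


section \<open>An approximate Poincare-Miranda theorem\<close>

text \<open>Kuhn's combinatorial lemma is stated for a dimension that is a natural number, unlike
  the library's Brouwer theorem, whose dimension is a type.\<close>
lemma poincare_miranda_approx:
  fixes g :: "(nat \<Rightarrow> real) \<Rightarrow> nat \<Rightarrow> real"
  assumes "0 < L" "0 < \<epsilon>"
    and unif: "\<exists>\<delta>>0. \<forall>x y. (\<forall>j<n. \<bar>x j\<bar> \<le> L \<and> \<bar>y j\<bar> \<le> L \<and> \<bar>x j - y j\<bar> \<le> \<delta>) \<longrightarrow>
      (\<forall>i<n. \<bar>g x i - g y i\<bar> \<le> \<epsilon>)"
    and lower: "\<And>x i. \<lbrakk>\<forall>j<n. \<bar>x j\<bar> \<le> L; i < n; x i = - L\<rbrakk> \<Longrightarrow> g x i \<le> 0"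
    and upper: "\<And>x i. \<lbrakk>\<forall>j<n. \<bar>x j\<bar> \<le> L; i < n; x i = L\<rbrakk> \<Longrightarrow> 0 \<le> g x i"
  shows "\<exists>x. (\<forall>j<n. \<bar>x j\<bar> \<le> L) \<and> (\<forall>i<n. \<bar>g x i\<bar> \<le> \<epsilon>)"
proof -
  obtain \<delta> where "\<delta> > 0" and \<delta>: "\<And>x y i. \<lbrakk>\<And>j. j < n \<Longrightarrow> \<bar>x j\<bar> \<le> L \<and> \<bar>y j\<bar> \<le> L \<and> \<bar>x j - y j\<bar> \<le> \<delta>; i < n\<rbrakk>
      \<Longrightarrow> \<bar>g x i - g y i\<bar> \<le> \<epsilon>"
    using unif by blast
  \<comment> \<open>The number of cells along each axis, chosen so that a cell has edge length
    \<open>2 * L / p \<le> \<delta>\<close>.\<close>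
  define p where "p = Suc (nat \<lceil>2 * L / \<delta>\<rceil>)"
  have "2 * L / \<delta> \<le> real p"
    unfolding p_def by linarith
  then have step: "2 * L / real p \<le> \<delta>"
    using \<open>\<delta> > 0\<close> by (simp add: p_def field_simps)
  have "0 < p" by (simp add: p_def)
  define grid :: "(nat \<Rightarrow> nat) \<Rightarrow> nat \<Rightarrow> real" where "grid x j = 2 * L / real p * real (x j) - L" for x j
  have grid_bound: "\<bar>grid x j\<bar> \<le> L" if "x j \<le> p" for x j
  proof -
    have "2 * L / real p * real (x j) \<le> 2 * L / real p * real p"
      using that \<open>0 < L\<close> by (intro mult_left_mono) auto
    moreover have "0 \<le> 2 * L / real p * real (x j)"
      using \<open>0 < L\<close> by simp
    ultimately show ?thesis
      using \<open>0 < p\<close> unfolding grid_def by (simp add: abs_le_iff)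
  qed
  \<comment> \<open>Kuhn's lemma prescribes label 0 on the face \<open>x i = 0\<close> and label 1
    on \<open>x i = p\<close>. Elsewhere the label is the sign of \<open>g\<close>, and the
    hypotheses on the faces keep the prescribed labels consistent with that sign.\<close>
  define label :: "(nat \<Rightarrow> nat) \<Rightarrow> nat \<Rightarrow> nat" where
    "label x i = (if x i \<noteq> 0 \<and> (x i = p \<or> 0 \<le> g (grid x) i) then 1 else 0)" for x i
  have label_0: "g (grid x) i \<le> 0" if "\<forall>j<n. x j \<le> p" "i < n" "label x i = 0" for x i
    using that lower[of "grid x" i] grid_bound[of x] by (fastforce simp: label_def grid_def split: if_splits)
  have label_1: "0 \<le> g (grid x) i" if "\<forall>j<n. x j \<le> p" "i < n" "label x i \<noteq> 0" for x i
    using that upper[of "grid x" i] grid_bound[of x] \<open>0 < p\<close>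
    by (fastforce simp: label_def grid_def split: if_splits)
  obtain q where q: "\<forall>i<n. q i < p"
    and labels: "\<forall>i<n. \<exists>r s. (\<forall>j<n. q j \<le> r j \<and> r j \<le> q j + 1) \<and>
      (\<forall>j<n. q j \<le> s j \<and> s j \<le> q j + 1) \<and> label r i \<noteq> label s i"
    by (rule kuhn_lemma[of p n label]) (use \<open>0 < p\<close> in \<open>auto simp: label_def\<close>)
  have "\<bar>g (grid q) i\<bar> \<le> \<epsilon>" if "i < n" for i
  proof -
    have close: "\<bar>g (grid q) i - g (grid r) i\<bar> \<le> \<epsilon>" and in_cube: "\<forall>j<n. r j \<le> p"
      if r: "\<forall>j<n. q j \<le> r j \<and> r j \<le> q j + 1" for r
    proof -
      show "\<forall>j<n. r j \<le> p" using q r by fastforce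
      have "\<bar>grid q j - grid r j\<bar> \<le> \<delta>" if "j < n" for j
      proof -
        have "\<bar>grid q j - grid r j\<bar> = 2 * L / real p * \<bar>real (q j) - real (r j)\<bar>"
        proof -
          have "grid q j - grid r j = 2 * L / real p * (real (q j) - real (r j))"
            by (simp add: grid_def right_diff_distrib)
          then show ?thesis using \<open>0 < L\<close> by (simp add: abs_mult)
        qed
        also have "\<dots> \<le> 2 * L / real p * 1"
          using r[rule_format, OF that] \<open>0 < L\<close> by (intro mult_left_mono) auto
        finally show ?thesis using step by simp
      qed
      then show "\<bar>g (grid q) i - g (grid r) i\<bar> \<le> \<epsilon>"
        using \<open>i < n\<close> \<open>\<forall>j<n. r j \<le> p\<close> q grid_bound by (intro \<delta>) (auto simp: less_imp_le)
    qed
    obtain r s where r: "\<forall>j<n. q j \<le> r j \<and> r j \<le> q j + 1" and s: "\<forall>j<n. q j \<le> s j \<and> s j \<le> q j + 1"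
      and "label r i \<noteq> label s i"
      using labels[rule_format, OF \<open>i < n\<close>] by (elim exE conjE) (rule that)
    then have "label r i = 0 \<and> label s i \<noteq> 0 \<or> label r i \<noteq> 0 \<and> label s i = 0"
      by (auto simp: label_def split: if_splits)
    \<comment> \<open>The cell has a corner where the component is at most 0 and another where it is
      at least 0; both values are within \<open>\<epsilon>\<close> of the value at
      \<open>grid q\<close>.\<close>
    then show ?thesis
      using close[OF r] close[OF s] label_0[OF in_cube[OF r] \<open>i < n\<close>] label_0[OF in_cube[OF s] \<open>i < n\<close>]
        label_1[OF in_cube[OF r] \<open>i < n\<close>] label_1[OF in_cube[OF s] \<open>i < n\<close>]
      by linarith
  qed
  then show ?thesis
    using q grid_bound by (intro exI[of _ "grid q"]) (auto simp: less_imp_le)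
qed

section \<open>Integrals with values in a complete inner product space\<close>

text \<open>The sort \<open>{real_inner, complete_space}\<close> is not below \<^class>\<open>banach\<close>, so the library's
  integrability criterion is transported through the isometric embedding into the dual space.\<close>
lemma continuous_has_integral_complete:
  fixes g :: "real \<Rightarrow> 'a::{real_inner, complete_space}"
  assumes g: "continuous_on {a..b} g"
  shows "\<exists>I. (g has_integral I) {a..b}"
proof -
  let ?J = "blinfun_inner_left :: 'a \<Rightarrow> 'a \<Rightarrow>\<^sub>L real"
  have lin: "bounded_linear ?J"
    by (rule bounded_linear_blinfun_inner_left)
  have norm_J: "norm (?J u) = norm u" for u
  proof (rule antisym)
    show "norm (?J u) \<le> norm u"
      using Cauchy_Schwarz_ineq2[of _ u] by (intro norm_blinfun_bound) (auto simp: mult.commute)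
    have "norm u * norm u \<le> norm (?J u) * norm u"
      using norm_blinfun[of "?J u" u] by (simp add: dot_square_norm power2_eq_square)
    then show "norm u \<le> norm (?J u)"
      by (cases "u = 0") auto
  qed
  have J_sum: "(\<Sum>(x,k)\<in>D. measure lborel k *\<^sub>R ?J (g x)) = ?J (\<Sum>(x,k)\<in>D. measure lborel k *\<^sub>R g x)"
    for D :: "(real \<times> real set) set"
    using bounded_linear.linear[OF lin]
    by (simp add: linear_sum linear_scale split_beta')
  have "continuous_on {a..b} (\<lambda>x. ?J (g x))"
    by (rule bounded_linear.continuous_on[OF lin g])
  then obtain y where y: "((\<lambda>x. ?J (g x)) has_integral y) {a..b}"
    using integrable_continuous_real by blast
  \<comment> \<open>Riemann sums of the embedded function are images of Riemann sums of
    \<open>g\<close>, so their limit \<open>y\<close> lies in the closure of the range, which is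
    closed because the domain is complete.\<close>
  have "y \<in> closure (range ?J)"
  proof (rule closure_approachable[THEN iffD2], intro allI impI)
    fix \<epsilon> :: real assume "\<epsilon> > 0"
    then obtain \<gamma> where "gauge \<gamma>"
      and \<gamma>: "\<And>D. D tagged_division_of {a..b} \<Longrightarrow> \<gamma> fine D \<Longrightarrow>
        norm ((\<Sum>(x,k)\<in>D. measure lborel k *\<^sub>R ?J (g x)) - y) < \<epsilon>"
      using y unfolding has_integral_real by meson
    obtain D where "D tagged_division_of {a..b}" "\<gamma> fine D"
      using fine_division_exists_real[OF \<open>gauge \<gamma>\<close>] by blast
    then show "\<exists>z\<in>range ?J. dist z y < \<epsilon>"
      using \<gamma> unfolding J_sum dist_norm by blast
  qed
  moreover have "closed (range ?J)"
    using complete_isometric_image[OF zero_less_one subspace_UNIV lin] norm_J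
    by (simp add: complete_UNIV complete_imp_closed)
  ultimately obtain I where I: "y = ?J I"
    by (auto simp: closure_closed)
  have "norm ((\<Sum>(x,k)\<in>D. measure lborel k *\<^sub>R ?J (g x)) - y) = norm ((\<Sum>(x,k)\<in>D. measure lborel k *\<^sub>R g x) - I)"
    for D :: "(real \<times> real set) set"
    unfolding J_sum I by (simp add: norm_J flip: linear_diff[OF bounded_linear.linear[OF lin]])
  then have "(g has_integral I) {a..b}"
    using y unfolding has_integral_real by simp
  then show ?thesis ..
qed

text \<open>Pairing with the direction \<open>sgn x\<close> reduces the bound to a comparison of two
  real integrals.\<close>

lemma has_integral_norm_le:
  fixes g :: "'b::euclidean_space \<Rightarrow> 'a::real_inner"
  assumes g: "(g has_integral x) S" and h: "(h has_integral y) S"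
    and le: "\<And>t. t \<in> S \<Longrightarrow> norm (g t) \<le> h t"
  shows "norm x \<le> y"
proof -
  have "((\<lambda>t. g t \<bullet> sgn x) has_integral (x \<bullet> sgn x)) S"
    using has_integral_linear[OF g bounded_linear_inner_left] by (simp add: o_def)
  moreover have "g t \<bullet> sgn x \<le> h t" if "t \<in> S" for t
  proof -
    have "norm (g t) * norm (sgn x) \<le> norm (g t) * 1"
      by (intro mult_left_mono) (auto simp: norm_sgn)
    then show ?thesis
      using norm_cauchy_schwarz[of "g t" "sgn x"] le[OF that] by linarith
  qed
  ultimately have "x \<bullet> sgn x \<le> y"
    by (rule has_integral_le[OF _ h])
  moreover have "x \<bullet> sgn x = norm x"
    by (cases "x = 0") (simp_all add: sgn_div_norm dot_square_norm power2_eq_square)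
  ultimately show ?thesis by simp
qed

lemma has_integral_exp_affine:
  fixes c d :: real
  assumes "c \<noteq> 0" "s \<le> t"
  shows "((\<lambda>\<tau>. exp (c * \<tau> + d)) has_integral (exp (c * t + d) - exp (c * s + d)) / c) {s..t}"
proof -
  have "((\<lambda>\<tau>. exp (c * \<tau> + d)) has_integral (exp (c * t + d) / c - exp (c * s + d) / c)) {s..t}"
    using assms
    by (intro fundamental_theorem_of_calculus)
       (auto intro!: derivative_eq_intros simp flip: has_real_derivative_iff_has_vector_derivative)
  then show ?thesis by (simp add: diff_divide_distrib)
qed

lemma exp_shift_mult: "exp (- l * t) * (exp (l * s) * x) = exp (- l * (t - s)) * x" for l s t x :: real
proof -
  have "exp (- l * t) * exp (l * s) = exp (- l * (t - s))"
    by (simp add: algebra_simps flip: exp_add)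
  then show ?thesis by (simp only: mult.assoc[symmetric])
qed

lemma continuous_on_atLeast:
  fixes f :: "real \<Rightarrow> 'b::topological_space"
  assumes "\<And>b. continuous_on {a..b} f"
  shows "continuous_on {a..} f"
  unfolding continuous_on_eq_continuous_within
proof
  fix t assume t: "t \<in> {a..}"
  have "at t within {a..} = at t within {a..t+1}"
    by (rule at_within_nhd[of t "{..<t+1}"]) auto
  then show "continuous (at t within {a..}) f"
    using assms[of "t+1"] t by (auto simp: continuous_on_eq_continuous_within)
qed

section \<open>Orthonormal bases and the diagonal semigroup\<close>

locale hilbert_basis =
  fixes e :: "nat \<Rightarrow> 'a::{real_inner, complete_space}"
  assumes orthonormal: "\<And>m n. e m \<bullet> e n = (if m = n then 1 else 0)"
    and complete: "\<And>u. (\<lambda>n. (u \<bullet> e n) *\<^sub>R e n) sums u"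
begin

lemma coeff_eqI:
  assumes "\<And>n. x \<bullet> e n = y \<bullet> e n"
  shows "x = y"
  using complete[of x] complete[of y] assms sums_unique2 by auto

lemma parseval: "(\<lambda>n. (x \<bullet> e n)\<^sup>2) sums (norm x)\<^sup>2"
  using bounded_linear.sums[OF bounded_linear_inner_right[of x] complete[of x]]
  by (simp add: power2_eq_square dot_square_norm)

text \<open>Parseval, compared term by term. Projections and the semigroup are diagonal, so their
  norm estimates all reduce to scalar inequalities through this lemma.\<close>

lemma norm_le_coeff:
  assumes "\<And>n. \<bar>x \<bullet> e n\<bar> \<le> \<bar>y \<bullet> e n\<bar>"
  shows "norm x \<le> norm y"
proof -
  have "(norm x)\<^sup>2 \<le> (norm y)\<^sup>2"
    using assms by (intro sums_le[OF _ parseval parseval]) (simp add: abs_le_square_iff)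
  then show ?thesis by (rule power2_le_imp_le) simp
qed

lemma norm_le_coeff_scaled:
  assumes "\<And>n. \<bar>x \<bullet> e n\<bar> \<le> c * \<bar>y \<bullet> e n\<bar>" "0 \<le> c"
  shows "norm x \<le> c * norm y"
  using norm_le_coeff[of x "c *\<^sub>R y"] assms by (simp add: abs_mult)

lemma coeff_sum:
  assumes "finite A"
  shows "(\<Sum>k\<in>A. a k *\<^sub>R e k) \<bullet> e j = (if j \<in> A then a j else 0)"
  using assms by (simp add: inner_sum_left orthonormal if_distrib cong: if_cong)

lemma abs_coeff_le: "\<bar>x \<bullet> e n\<bar> \<le> norm x"
  using Cauchy_Schwarz_ineq2[of x "e n"] orthonormal[of n n] by (simp add: norm_eq_sqrt_inner)

text \<open>Differences of partial sums are dominated coefficientwise by those of the expansion of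
  \<open>u\<close>, hence the partial sums are Cauchy. This gives meaning to the series that defines
  \<open>expA\<close>.\<close>

lemma multiplier_summable:
  assumes "\<And>n. \<bar>c n\<bar> \<le> 1"
  shows "summable (\<lambda>n. c n *\<^sub>R ((u \<bullet> e n) *\<^sub>R e n))"
proof -
  let ?s = "\<lambda>n. \<Sum>k<n. c k *\<^sub>R ((u \<bullet> e k) *\<^sub>R e k)" and ?S = "\<lambda>n. \<Sum>k<n. (u \<bullet> e k) *\<^sub>R e k"
  have le: "norm (?s m - ?s n) \<le> norm (?S m - ?S n)" for m n
  proof (rule norm_le_coeff)
    fix j
    have "\<bar>c j * (u \<bullet> e j)\<bar> \<le> 1 * \<bar>u \<bullet> e j\<bar>"
      unfolding abs_mult using assms by (intro mult_right_mono) auto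
    then show "\<bar>(?s m - ?s n) \<bullet> e j\<bar> \<le> \<bar>(?S m - ?S n) \<bullet> e j\<bar>"
      using coeff_sum[of "{..<m}" "\<lambda>k. c k * (u \<bullet> e k)" j] coeff_sum[of "{..<n}" "\<lambda>k. c k * (u \<bullet> e k)" j]
      by (auto simp: inner_diff_left coeff_sum)
  qed
  have "Cauchy ?S"
    using complete[of u] unfolding sums_def by (rule LIMSEQ_imp_Cauchy)
  then have "Cauchy ?s"
    unfolding Cauchy_def dist_norm using le by (meson le_less_trans)
  then show ?thesis
    by (simp add: Cauchy_convergent_iff summable_iff_convergent)
qed

lemma multiplier_coeff:
  assumes "\<And>n. \<bar>c n\<bar> \<le> 1"
  shows "(\<Sum>n. c n *\<^sub>R ((u \<bullet> e n) *\<^sub>R e n)) \<bullet> e j = c j * (u \<bullet> e j)"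
proof -
  have "(\<lambda>n. (c n *\<^sub>R ((u \<bullet> e n) *\<^sub>R e n)) \<bullet> e j) sums ((\<Sum>n. c n *\<^sub>R ((u \<bullet> e n) *\<^sub>R e n)) \<bullet> e j)"
    using bounded_linear.sums[OF bounded_linear_inner_left summable_sums[OF multiplier_summable[of c u, OF assms]]] .
  also have "(\<lambda>n. (c n *\<^sub>R ((u \<bullet> e n) *\<^sub>R e n)) \<bullet> e j) = (\<lambda>n. if n = j then c n * (u \<bullet> e n) else 0)"
    by (auto simp: orthonormal)
  finally show ?thesis
    using sums_unique2 sums_single[of j "\<lambda>n. c n * (u \<bullet> e n)"] by blast
qed

lemma coeff_Pproj: "Pproj e M u \<bullet> e j = (if j < M then u \<bullet> e j else 0)"
  unfolding Pproj_def by (subst coeff_sum) auto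

lemma coeff_Qproj: "Qproj e M u \<bullet> e j = (if j < M then 0 else u \<bullet> e j)"
  unfolding Qproj_def by (simp add: inner_diff_left coeff_Pproj)

lemma Pproj_plus_Qproj: "Pproj e M u + Qproj e M u = u"
  by (simp add: Qproj_def)

lemma norm_Pproj_le: "norm (Pproj e M u) \<le> norm u"
  by (rule norm_le_coeff) (simp add: coeff_Pproj)

lemma norm_Qproj_le: "norm (Qproj e M u) \<le> norm u"
  by (rule norm_le_coeff) (simp add: coeff_Qproj)

lemma norm_Qproj_antimono: "M \<le> M' \<Longrightarrow> norm (Qproj e M' u) \<le> norm (Qproj e M u)"
  by (rule norm_le_coeff) (simp add: coeff_Qproj)

lemma bounded_linear_Pproj: "bounded_linear (Pproj e M)"
  unfolding Pproj_def
  by (intro bounded_linear_sum bounded_linear_scaleR_const bounded_linear_inner_left)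

lemma bounded_linear_Qproj: "bounded_linear (Qproj e M)"
  unfolding Qproj_def by (intro bounded_linear_sub bounded_linear_ident bounded_linear_Pproj)

lemmas Pproj_diff = linear_diff[OF bounded_linear.linear[OF bounded_linear_Pproj]]
  and Qproj_diff = linear_diff[OF bounded_linear.linear[OF bounded_linear_Qproj]]

lemma Pproj_idem: "Pproj e M (Pproj e M u) = Pproj e M u"
  and Qproj_idem: "Qproj e M (Qproj e M u) = Qproj e M u"
  and Pproj_Qproj: "Pproj e M (Qproj e M u) = 0"
  and Qproj_Pproj: "M \<le> M' \<Longrightarrow> Qproj e M' (Pproj e M u) = 0"
  by (rule coeff_eqI; simp add: coeff_Pproj coeff_Qproj)+

lemma Qproj_tendsto_0: "(\<lambda>M. Qproj e M u) \<longlonglongrightarrow> 0"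
  using tendsto_diff[OF tendsto_const[of u] complete[of u, unfolded sums_def]]
  by (simp add: Qproj_def Pproj_def)

text \<open>Bounded coefficients converge along a subsequence, so every finite part converges; the
  common rate \<open>d\<close> controls what is left, and the subsequence is Cauchy in norm.\<close>

lemma compact_tail_set:
  assumes d: "d \<longlonglongrightarrow> 0"
  shows "compact {u. norm u \<le> c \<and> (\<forall>M\<ge>N. norm (Qproj e M u) \<le> d M)}" (is "compact ?K")
  unfolding compact_eq_seq_compact_metric
proof (rule seq_compactI)
  fix f :: "nat \<Rightarrow> 'a" assume f: "\<forall>k. f k \<in> ?K"
  have coeff: "f k \<bullet> e n \<in> {-c..c}" for k n
  proof -
    have "norm (f k) \<le> c" using f by auto
    then show ?thesis using abs_coeff_le[of "f k" n] by (simp add: abs_le_iff)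
  qed
  obtain l r where r: "strict_mono r" and l: "\<And>n. (\<lambda>k. f (r k) \<bullet> e n) \<longlonglongrightarrow> l n"
    and "\<And>n. l n \<in> {-c..c}"
    by (rule compact_sequences_coordinatewise[of "\<lambda>_. {-c..c}" "\<lambda>k n. f k \<bullet> e n", OF compact_Icc coeff]) (rule that)
  have "Cauchy (f \<circ> r)"
  proof (rule metric_CauchyI)
    fix \<epsilon> :: real assume "\<epsilon> > 0"
    \<comment> \<open>The two tails take \<open>\<epsilon> / 4\<close> each and the finite part
      takes \<open>\<epsilon> / 2\<close>.\<close>
    then have "\<forall>\<^sub>F M in sequentially. d M < \<epsilon> / 4"
      by (intro order_tendstoD(2)[OF d]) simp
    then obtain M where "M \<ge> N" and M: "d M < \<epsilon> / 4"
      unfolding eventually_sequentially by (meson nat_le_linear order_refl order_trans)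
    have "(\<lambda>k. Pproj e M (f (r k))) \<longlonglongrightarrow> (\<Sum>n<M. l n *\<^sub>R e n)"
      unfolding Pproj_def by (intro tendsto_intros l)
    then have "Cauchy (\<lambda>k. Pproj e M (f (r k)))"
      by (rule LIMSEQ_imp_Cauchy)
    moreover have "0 < \<epsilon> / 2" using \<open>\<epsilon> > 0\<close> by simp
    ultimately obtain k0 where k0: "\<forall>i\<ge>k0. \<forall>j\<ge>k0. dist (Pproj e M (f (r i))) (Pproj e M (f (r j))) < \<epsilon> / 2"
      using metric_CauchyD by blast
    have "dist ((f \<circ> r) i) ((f \<circ> r) j) < \<epsilon>" if "i \<ge> k0" "j \<ge> k0" for i j
    proof -
      have tail: "norm (Qproj e M (f (r k))) < \<epsilon> / 4" for k
      proof -
        have "norm (Qproj e M (f (r k))) \<le> d M" using f \<open>M \<ge> N\<close> by simp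
        then show ?thesis using M by simp
      qed
      have "dist (f (r i)) (f (r j)) = norm ((Pproj e M (f (r i)) - Pproj e M (f (r j))) +
          (Qproj e M (f (r i)) - Qproj e M (f (r j))))"
        by (simp add: dist_norm Qproj_def)
      also have "\<dots> \<le> dist (Pproj e M (f (r i))) (Pproj e M (f (r j))) +
          (norm (Qproj e M (f (r i))) + norm (Qproj e M (f (r j))))"
        unfolding dist_norm by (intro norm_triangle_mono norm_triangle_ineq4 order_refl)
      also have "\<dots> < \<epsilon>"
        using k0[rule_format, OF that] tail[of i] tail[of j] by linarith
      finally show ?thesis by simp
    qed
    then show "\<exists>k0. \<forall>i\<ge>k0. \<forall>j\<ge>k0. dist ((f \<circ> r) i) ((f \<circ> r) j) < \<epsilon>"
      by blast
  qed
  then obtain u where u: "(f \<circ> r) \<longlonglongrightarrow> u"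
    using Cauchy_convergent_iff convergent_def by blast
  have "norm u \<le> c"
    by (rule LIMSEQ_le_const2[OF tendsto_norm[OF u]]) (use f in auto)
  moreover have "norm (Qproj e M u) \<le> d M" if "M \<ge> N" for M
    by (rule LIMSEQ_le_const2[OF tendsto_norm[OF bounded_linear.tendsto[OF bounded_linear_Qproj u]]])
       (use f that in auto)
  ultimately show "\<exists>l\<in>?K. \<exists>r. strict_mono r \<and> (f \<circ> r) \<longlonglongrightarrow> l"
    using r u by blast
qed

end

section \<open>The semigroup generated by a diagonal operator\<close>

locale diagonal_semigroup = hilbert_basis e for e :: "nat \<Rightarrow> 'a::{real_inner, complete_space}" +
  fixes lam :: "nat \<Rightarrow> real"
  assumes lam_pos: "\<And>n. 0 < lam n"
    and lam_mono: "mono lam"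
    and lam_infty: "filterlim lam at_top sequentially"
begin

lemma coeff_expA:
  assumes "0 \<le> t"
  shows "expA e lam t u \<bullet> e n = exp (- lam n * t) * (u \<bullet> e n)"
  unfolding expA_def using assms lam_pos by (intro multiplier_coeff) (simp add: less_imp_le)

lemma norm_expA_le: "0 \<le> t \<Longrightarrow> norm (expA e lam t u) \<le> norm u"
  using lam_pos
  by (intro norm_le_coeff) (simp add: coeff_expA abs_mult mult_left_le_one_le less_imp_le)

lemma expA_0: "expA e lam 0 u = u"
  by (rule coeff_eqI) (simp add: coeff_expA)

lemma expA_diff: "0 \<le> t \<Longrightarrow> expA e lam t (u - v) = expA e lam t u - expA e lam t v"
  by (rule coeff_eqI) (simp add: coeff_expA algebra_simps)

text \<open>The slowest decaying mode that survives \<open>Qproj e M\<close> is the one with index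
  \<open>M\<close>.\<close>

lemma norm_Qproj_expA_le:
  assumes "0 \<le> t"
  shows "norm (Qproj e M (expA e lam t u)) \<le> exp (- lam M * t) * norm (Qproj e M u)"
  using assms monoD[OF lam_mono]
  by (intro norm_le_coeff_scaled)
     (auto simp: coeff_Qproj coeff_expA abs_mult intro!: mult_right_mono)

text \<open>Modes below \<open>M\<close> decay at most at rate \<open>lam M\<close>, so undoing the
  semigroup on them costs at most this exponential factor.\<close>

lemma norm_Pproj_le_expA:
  assumes "0 \<le> t"
  shows "norm (Pproj e M u) \<le> exp (lam M * t) * norm (Pproj e M (expA e lam t u))"
proof (rule norm_le_coeff_scaled)
  fix n
  have "1 \<le> exp (lam M * t) * exp (- lam n * t)" if "n < M"
    using that assms monoD[OF lam_mono, of n M] by (simp add: mult_right_mono flip: exp_add)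
  then have "1 * \<bar>u \<bullet> e n\<bar> \<le> exp (lam M * t) * exp (- lam n * t) * \<bar>u \<bullet> e n\<bar>" if "n < M"
    using that by (intro mult_right_mono) auto
  then show "\<bar>Pproj e M u \<bullet> e n\<bar> \<le> exp (lam M * t) * \<bar>Pproj e M (expA e lam t u) \<bullet> e n\<bar>"
    using assms by (auto simp: coeff_Pproj coeff_expA abs_mult exp_add mult.assoc simp del: exp_le_cancel_iff)
qed simp

text \<open>The truncations \<open>P\<^sub>M exp(-At)u\<close> converge uniformly in \<open>t \<ge> 0\<close>.\<close>
lemma continuous_on_expA: "continuous_on {0..} (\<lambda>t. expA e lam t u)"
proof (rule uniform_limit_theorem)
  show "\<forall>\<^sub>F M in sequentially. continuous_on {0..} (\<lambda>t. \<Sum>n<M. (exp (- lam n * t) * (u \<bullet> e n)) *\<^sub>R e n)"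
    by (intro always_eventually allI continuous_intros)
  show "uniform_limit {0..} (\<lambda>M t. \<Sum>n<M. (exp (- lam n * t) * (u \<bullet> e n)) *\<^sub>R e n)
     (\<lambda>t. expA e lam t u) sequentially"
  proof (rule uniform_limitI)
    fix \<epsilon> :: real assume "\<epsilon> > 0"
    have "\<forall>\<^sub>F M in sequentially. norm (Qproj e M u) < \<epsilon>"
      using tendstoD[OF Qproj_tendsto_0 \<open>\<epsilon> > 0\<close>, of u] by simp
    then show "\<forall>\<^sub>F M in sequentially. \<forall>t\<in>{0..}. dist (\<Sum>n<M. (exp (- lam n * t) * (u \<bullet> e n)) *\<^sub>R e n) (expA e lam t u) < \<epsilon>"
    proof eventually_elim
      case (elim M)
      show ?case
      proof
        fix t :: real assume t: "t \<in> {0..}"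
        have "expA e lam t u - (\<Sum>n<M. (exp (- lam n * t) * (u \<bullet> e n)) *\<^sub>R e n) = Qproj e M (expA e lam t u)"
          using t by (simp add: Qproj_def Pproj_def coeff_expA)
        then have "dist (\<Sum>n<M. (exp (- lam n * t) * (u \<bullet> e n)) *\<^sub>R e n) (expA e lam t u) = norm (Qproj e M (expA e lam t u))"
          by (simp add: dist_norm norm_minus_commute)
        also have "\<dots> \<le> 1 * norm (Qproj e M u)"
          using t lam_pos[of M]
          by (intro order_trans[OF norm_Qproj_expA_le] mult_right_mono) auto
        finally show "dist (\<Sum>n<M. (exp (- lam n * t) * (u \<bullet> e n)) *\<^sub>R e n) (expA e lam t u) < \<epsilon>"
          using elim by simp
      qed
    qed
  qed
qed simp

text \<open>Strong continuity at the fixed vector \<open>g a\<close> combines with the contraction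
  property, which bounds the effect of replacing \<open>g \<tau>\<close> by \<open>g a\<close>
  uniformly in time.\<close>

lemma continuous_on_expA_compose:
  assumes g: "continuous_on {s..t} g"
  shows "continuous_on {s..t} (\<lambda>\<tau>. expA e lam (t - \<tau>) (g \<tau>))"
  unfolding continuous_on_def
proof
  fix a assume a: "a \<in> {s..t}"
  let ?F = "at a within {s..t}"
  let ?E = "\<lambda>\<tau>. expA e lam (t - \<tau>)"
  have "continuous_on {s..t} (\<lambda>\<tau>. ?E \<tau> (g a))"
    by (rule continuous_on_compose2[OF continuous_on_expA]) (auto intro!: continuous_intros)
  then have 1: "((\<lambda>\<tau>. ?E \<tau> (g a)) \<longlongrightarrow> ?E a (g a)) ?F"
    using a by (simp add: continuous_on_def)
  have "(g \<longlongrightarrow> g a) ?F"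
    using g a by (simp add: continuous_on_def)
  then have lim: "((\<lambda>\<tau>. norm (g \<tau> - g a)) \<longlongrightarrow> 0) ?F"
    by (intro tendsto_norm_zero LIM_zero)
  have "\<forall>\<^sub>F \<tau> in ?F. norm (?E \<tau> (g \<tau>) - ?E \<tau> (g a)) \<le> norm (g \<tau> - g a)"
    by (auto simp: eventually_at_filter norm_expA_le simp flip: expA_diff)
  then have "((\<lambda>\<tau>. ?E \<tau> (g \<tau>) - ?E \<tau> (g a)) \<longlongrightarrow> 0) ?F"
    by (rule Lim_null_comparison[OF _ lim])
  from tendsto_add[OF this 1] show "((\<lambda>\<tau>. ?E \<tau> (g \<tau>)) \<longlongrightarrow> ?E a (g a)) ?F"
    by simp
qed

section \<open>Convolution integrals with the semigroup\<close>

lemma mild_integral_exists: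
  assumes "continuous_on {s..t} g"
  shows "\<exists>I. ((\<lambda>\<tau>. expA e lam (t - \<tau>) (g \<tau>)) has_integral I) {s..t}"
  by (intro continuous_has_integral_complete continuous_on_expA_compose assms)

lemma mild_integral_coeff:
  assumes "((\<lambda>\<tau>. expA e lam (t - \<tau>) (g \<tau>)) has_integral I) {s..t}"
  shows "((\<lambda>\<tau>. exp (- lam n * (t - \<tau>)) * (g \<tau> \<bullet> e n)) has_integral I \<bullet> e n) {s..t}"
proof -
  have "((\<lambda>\<tau>. expA e lam (t - \<tau>) (g \<tau>) \<bullet> e n) has_integral I \<bullet> e n) {s..t}"
    using has_integral_linear[OF assms bounded_linear_inner_left] by (simp add: o_def)
  then show ?thesis
    by (rule has_integral_eq[rotated]) (simp add: coeff_expA)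
qed

text \<open>The kernel \<open>exp (- lam M * (t - \<tau>))\<close> has integral at most
  \<open>1 / lam M\<close> over any stretch of the past, so the bound is independent of
  \<open>t - s\<close>. For \<open>M = 0\<close> it bounds the whole norm.\<close>

lemma norm_Qproj_mild_integral_le:
  assumes I: "((\<lambda>\<tau>. expA e lam (t - \<tau>) (g \<tau>)) has_integral I) {s..t}" and "s \<le> t"
    and g: "\<And>\<tau>. \<tau> \<in> {s..t} \<Longrightarrow> norm (g \<tau>) \<le> K"
  shows "norm (Qproj e M I) \<le> K / lam M"
proof -
  have K: "0 \<le> K" using \<open>s \<le> t\<close> by (intro order_trans[OF norm_ge_zero g[of s]]) auto
  have "((\<lambda>\<tau>. Qproj e M (expA e lam (t - \<tau>) (g \<tau>))) has_integral Qproj e M I) {s..t}"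
    using has_integral_linear[OF I bounded_linear_Qproj] by (simp add: o_def)
  moreover have "((\<lambda>\<tau>. exp (lam M * \<tau> + - lam M * t) * K) has_integral
      (exp (lam M * t + - lam M * t) - exp (lam M * s + - lam M * t)) / lam M * K) {s..t}"
    using lam_pos[of M] \<open>s \<le> t\<close> by (intro has_integral_mult_left has_integral_exp_affine) auto
  moreover have "norm (Qproj e M (expA e lam (t - \<tau>) (g \<tau>))) \<le> exp (lam M * \<tau> + - lam M * t) * K"
    if "\<tau> \<in> {s..t}" for \<tau>
  proof -
    have "norm (Qproj e M (expA e lam (t - \<tau>) (g \<tau>))) \<le> exp (- lam M * (t - \<tau>)) * norm (Qproj e M (g \<tau>))"
      using that by (intro norm_Qproj_expA_le) auto
    also have "\<dots> \<le> exp (- lam M * (t - \<tau>)) * K"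
      using g[OF that] norm_Qproj_le[of M "g \<tau>"] by (intro mult_left_mono) auto
    finally show ?thesis by (simp add: algebra_simps)
  qed
  ultimately have "norm (Qproj e M I) \<le> (exp (lam M * t + - lam M * t) - exp (lam M * s + - lam M * t)) / lam M * K"
    by (rule has_integral_norm_le)
  also have "\<dots> = (1 - exp (lam M * s + - lam M * t)) * (K / lam M)"
    by simp
  also have "\<dots> \<le> 1 * (K / lam M)"
    using lam_pos[of M] K by (intro mult_right_mono) auto
  finally show ?thesis by simp
qed

definition mild_conv :: "(real \<Rightarrow> 'a) \<Rightarrow> real \<Rightarrow> 'a" where
  "mild_conv g t = integral {0..t} (\<lambda>\<tau>. expA e lam (t - \<tau>) (g \<tau>))"

lemma has_integral_mild_conv:
  assumes "continuous_on {0..} g"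
  shows "((\<lambda>\<tau>. expA e lam (t - \<tau>) (g \<tau>)) has_integral mild_conv g t) {0..t}"
  using mild_integral_exists[OF continuous_on_subset[OF assms, of "{0..t}"]]
  unfolding mild_conv_def by (auto simp: integrable_on_def)

text \<open>With the factor \<open>exp (- lam n * t)\<close> taken out, the integrand no longer
  depends on \<open>t\<close>; what remains is an indefinite integral, which is continuous and
  additive over intervals.\<close>

lemma coeff_mild_conv:
  assumes g: "continuous_on {0..} g"
  shows "mild_conv g t \<bullet> e n = exp (- lam n * t) * integral {0..t} (\<lambda>\<tau>. exp (lam n * \<tau>) * (g \<tau> \<bullet> e n))"
proof -
  have "(\<lambda>\<tau>. exp (lam n * \<tau>) * (g \<tau> \<bullet> e n)) integrable_on {0..t}"
    by (intro integrable_continuous_real continuous_intros continuous_on_subset[OF g]) auto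
  then have "((\<lambda>\<tau>. exp (- lam n * t) * (exp (lam n * \<tau>) * (g \<tau> \<bullet> e n))) has_integral
      exp (- lam n * t) * integral {0..t} (\<lambda>\<tau>. exp (lam n * \<tau>) * (g \<tau> \<bullet> e n))) {0..t}"
    by (intro has_integral_mult_right integrable_integral)
  then have "((\<lambda>\<tau>. exp (- lam n * (t - \<tau>)) * (g \<tau> \<bullet> e n)) has_integral
      exp (- lam n * t) * integral {0..t} (\<lambda>\<tau>. exp (lam n * \<tau>) * (g \<tau> \<bullet> e n))) {0..t}"
    by (simp only: exp_shift_mult)
  then show ?thesis
    by (rule has_integral_unique[OF mild_integral_coeff[OF has_integral_mild_conv[OF g]]])
qed

lemma norm_Qproj_mild_conv_le:
  assumes "continuous_on {0..} g" "\<And>\<tau>. norm (g \<tau>) \<le> K" "0 \<le> t"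
  shows "norm (Qproj e M (mild_conv g t)) \<le> K / lam M"
  using norm_Qproj_mild_integral_le[OF has_integral_mild_conv] assms by blast

text \<open>Each coefficient is continuous, and the tails \<open>Q\<^sub>M\<close> are small uniformly in time.\<close>
lemma continuous_on_mild_conv:
  assumes g: "continuous_on {0..} g" and bound: "\<And>\<tau>. norm (g \<tau>) \<le> K"
  shows "continuous_on {0..} (mild_conv g)"
proof (rule uniform_limit_theorem)
  have "continuous_on {0..} (\<lambda>t. mild_conv g t \<bullet> e n)" for n
  proof (rule continuous_on_atLeast)
    fix b
    have "(\<lambda>\<tau>. exp (lam n * \<tau>) * (g \<tau> \<bullet> e n)) integrable_on {0..b}"
      by (intro integrable_continuous_real continuous_intros continuous_on_subset[OF g]) auto
    then show "continuous_on {0..b} (\<lambda>t. mild_conv g t \<bullet> e n)"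
      unfolding coeff_mild_conv[OF g] by (intro continuous_intros indefinite_integral_continuous_1)
  qed
  then show "\<forall>\<^sub>F M in sequentially. continuous_on {0..} (\<lambda>t. Pproj e M (mild_conv g t))"
    unfolding Pproj_def
    by (intro always_eventually allI continuous_on_sum continuous_on_scaleR continuous_on_const)
  show "uniform_limit {0..} (\<lambda>M t. Pproj e M (mild_conv g t)) (mild_conv g) sequentially"
  proof (rule uniform_limitI)
    fix \<epsilon> :: real assume "\<epsilon> > 0"
    have "(\<lambda>M. K / lam M) \<longlonglongrightarrow> 0"
      by (rule tendsto_divide_0[OF tendsto_const filterlim_mono[OF lam_infty at_top_le_at_infinity order_refl]])
    then have "\<forall>\<^sub>F M in sequentially. K / lam M < \<epsilon>"
      using \<open>\<epsilon> > 0\<close> by (rule order_tendstoD)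
    then show "\<forall>\<^sub>F M in sequentially. \<forall>t\<in>{0..}. dist (Pproj e M (mild_conv g t)) (mild_conv g t) < \<epsilon>"
    proof eventually_elim
      case (elim M)
      show ?case
      proof
        fix t :: real assume t: "t \<in> {0..}"
        then have "norm (Qproj e M (mild_conv g t)) < \<epsilon>"
          using norm_Qproj_mild_conv_le[OF g bound, of t M] elim by simp
        then show "dist (Pproj e M (mild_conv g t)) (mild_conv g t) < \<epsilon>"
          by (simp add: dist_norm Qproj_def norm_minus_commute)
      qed
    qed
  qed
qed simp

end

section \<open>Mild solutions\<close>

locale semilinear = diagonal_semigroup e lam for e :: "nat \<Rightarrow> 'a::{real_inner, complete_space}" and lam +
  fixes F :: "'a \<Rightarrow> 'a" and K0 K1 :: real
  assumes K1_pos: "0 < K1"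
    and F_bound: "\<And>u. norm (F u) \<le> K0"
    and F_lip: "\<And>u v. norm (F u - F v) \<le> K1 * norm (u - v)"
begin

lemma K0_nonneg: "0 \<le> K0"
  using F_bound[of undefined] norm_ge_zero order_trans by blast

lemma continuous_on_F: "continuous_on S F"
  by (rule lipschitz_on_continuous_on[of K1])
     (use K1_pos F_lip in \<open>auto simp: lipschitz_on_def dist_norm\<close>)

lemma continuous_on_F_compose: "continuous_on S u \<Longrightarrow> continuous_on S (\<lambda>t. F (u t))"
  by (rule continuous_on_compose2[OF continuous_on_F[of UNIV]]) auto

text \<open>The variation of constants formula anchored at time 0 implies it for all
  \<open>s \<le> t\<close>: for each coefficient, the integral over \<open>{s..t}\<close> is the
  difference of two integrals starting at 0.\<close>

lemma is_solutionI_coeff: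
  assumes u: "continuous_on {0..} u"
    and coeff: "\<And>t n. 0 \<le> t \<Longrightarrow> u t \<bullet> e n =
      exp (- lam n * t) * (u 0 \<bullet> e n + integral {0..t} (\<lambda>\<tau>. exp (lam n * \<tau>) * (F (u \<tau>) \<bullet> e n)))"
  shows "is_solution e lam F {0..} u"
  unfolding is_solution_def
proof (intro conjI ballI impI u)
  fix s t :: real assume st: "s \<in> {0..}" "t \<in> {0..}" "s \<le> t"
  have cF: "continuous_on {0..} (\<lambda>\<tau>. F (u \<tau>))"
    by (rule continuous_on_F_compose[OF u])
  obtain I where I: "((\<lambda>\<tau>. expA e lam (t - \<tau>) (F (u \<tau>))) has_integral I) {s..t}"
    using mild_integral_exists[OF continuous_on_subset[OF cF, of "{s..t}"]] st by auto
  have "I = u t - expA e lam (t - s) (u s)"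
  proof (rule coeff_eqI)
    fix n
    let ?\<phi> = "\<lambda>\<tau>. exp (lam n * \<tau>) * (F (u \<tau>) \<bullet> e n)"
    have int: "?\<phi> integrable_on {a..t}" if "0 \<le> a" for a
      using that by (intro integrable_continuous_real continuous_intros continuous_on_subset[OF cF]) auto
    have "((\<lambda>\<tau>. exp (- lam n * t) * ?\<phi> \<tau>) has_integral exp (- lam n * t) * integral {s..t} ?\<phi>) {s..t}"
      using int[of s] st by (intro has_integral_mult_right integrable_integral) auto
    then have "I \<bullet> e n = exp (- lam n * t) * integral {s..t} ?\<phi>"
      unfolding exp_shift_mult by (rule has_integral_unique[OF mild_integral_coeff[OF I]])
    moreover have "integral {s..t} ?\<phi> = integral {0..t} ?\<phi> - integral {0..s} ?\<phi>"
      using st int[of 0] Henstock_Kurzweil_Integration.integral_combine[of 0 s t ?\<phi>] by auto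
    moreover have "exp (- lam n * (t - s)) * (u s \<bullet> e n) = exp (- lam n * t) * (u 0 \<bullet> e n + integral {0..s} ?\<phi>)"
    proof -
      have "exp (- lam n * (t - s)) * exp (- lam n * s) = exp (- lam n * t)"
        by (simp add: algebra_simps flip: exp_add)
      then show ?thesis
        using st coeff[of s n] by (simp only: atLeast_iff mult.assoc[symmetric])
    qed
    moreover have "(u t - expA e lam (t - s) (u s)) \<bullet> e n = u t \<bullet> e n - exp (- lam n * (t - s)) * (u s \<bullet> e n)"
      using st by (simp add: inner_diff_left coeff_expA)
    ultimately show "I \<bullet> e n = (u t - expA e lam (t - s) (u s)) \<bullet> e n"
      using st coeff[of t n] by (simp add: ring_distribs)
  qed
  then show "((\<lambda>\<tau>. expA e lam (t - \<tau>) (F (u \<tau>))) has_integral u t - expA e lam (t - s) (u s)) {s..t}"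
    using I by simp
qed

lemma is_solution_subset: "is_solution e lam F J u \<Longrightarrow> J' \<subseteq> J \<Longrightarrow> is_solution e lam F J' u"
  unfolding is_solution_def by (blast intro: continuous_on_subset)

section \<open>A priori bounds from the boundedness of the nonlinearity\<close>

lemma is_solutionD:
  assumes "is_solution e lam F J u" "s \<in> J" "t \<in> J" "s \<le> t"
  shows "((\<lambda>\<tau>. expA e lam (t - \<tau>) (F (u \<tau>))) has_integral (u t - expA e lam (t - s) (u s))) {s..t}"
  using assms unfolding is_solution_def by blast

lemma solution_linear_part_le:
  assumes "is_solution e lam F J u" "s \<in> J" "t \<in> J" "s \<le> t"
  shows "norm (u t - expA e lam (t - s) (u s)) \<le> K0 * (t - s)"
proof -
  have "((\<lambda>\<tau>. K0) has_integral measure lborel {s..t} *\<^sub>R K0) {s..t}"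
    by (rule has_integral_const_real)
  then have "norm (u t - expA e lam (t - s) (u s)) \<le> measure lborel {s..t} *\<^sub>R K0"
  proof (rule has_integral_norm_le[OF is_solutionD[OF assms]])
    fix \<tau> assume "\<tau> \<in> {s..t}"
    then have "norm (expA e lam (t - \<tau>) (F (u \<tau>))) \<le> norm (F (u \<tau>))"
      by (intro norm_expA_le) simp
    then show "norm (expA e lam (t - \<tau>) (F (u \<tau>))) \<le> K0"
      using F_bound[of "u \<tau>"] by linarith
  qed
  then show ?thesis
    using \<open>s \<le> t\<close> by (simp add: mult.commute)
qed

text \<open>The memory of the state at time \<open>s\<close> decays while the forcing contributes a
  fixed amount. Letting \<open>s\<close> tend to minus infinity later removes the first
  term.\<close>

lemma solution_Qproj_le:
  assumes u: "is_solution e lam F J u" "s \<in> J" "t \<in> J" "s \<le> t"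
  shows "norm (Qproj e M (u t)) \<le> exp (- lam M * (t - s)) * norm (Qproj e M (u s)) + K0 / lam M"
proof -
  have "norm (Qproj e M (u t - expA e lam (t - s) (u s))) \<le> K0 / lam M"
    by (rule norm_Qproj_mild_integral_le[OF is_solutionD[OF u] \<open>s \<le> t\<close> F_bound])
  moreover have "norm (Qproj e M (expA e lam (t - s) (u s))) \<le> exp (- lam M * (t - s)) * norm (Qproj e M (u s))"
    using \<open>s \<le> t\<close> by (intro norm_Qproj_expA_le) simp
  ultimately show ?thesis
    using norm_triangle_sub[of "Qproj e M (u t)" "Qproj e M (expA e lam (t - s) (u s))"]
    by (simp add: Qproj_diff)
qed

text \<open>On finitely many modes the linear part can be inverted, so the \<open>P\<close>-part at
  an earlier time is controlled by the later one, even though the equation cannot be solved backward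
  in general.\<close>

lemma solution_Pproj_le:
  assumes u: "is_solution e lam F J u" "s \<in> J" "t \<in> J" "s \<le> t"
  shows "norm (Pproj e M (u s)) \<le> exp (lam M * (t - s)) * (norm (Pproj e M (u t)) + K0 * (t - s))"
proof -
  have "norm (Pproj e M (u s)) \<le> exp (lam M * (t - s)) * norm (Pproj e M (expA e lam (t - s) (u s)))"
    using \<open>s \<le> t\<close> by (intro norm_Pproj_le_expA) simp
  also have "norm (Pproj e M (expA e lam (t - s) (u s))) \<le>
      norm (Pproj e M (u t)) + norm (Pproj e M (u t - expA e lam (t - s) (u s)))"
    using norm_triangle_ineq4[of "Pproj e M (u t)" "Pproj e M (u t - expA e lam (t - s) (u s))"]
    by (simp add: Pproj_diff)
  also have "norm (Pproj e M (u t - expA e lam (t - s) (u s))) \<le> K0 * (t - s)"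
    using solution_linear_part_le[OF u] norm_Pproj_le order_trans by blast
  finally show ?thesis by simp
qed

text \<open>Integrating \<open>K1 * exp (2 * K1 * \<tau>)\<close> gains a factor
  \<open>1 / (2 * K1)\<close>, which leaves the contraction constant 1/2. Both uniqueness and
  existence rest on this estimate.\<close>

lemma K1_integral_le:
  assumes g: "((\<lambda>\<tau>. expA e lam (t - \<tau>) (g \<tau>)) has_integral I) {s..t}" and "s \<le> t" "0 \<le> m"
    and bound: "\<And>\<tau>. \<tau> \<in> {s..t} \<Longrightarrow> norm (g \<tau>) \<le> K1 * (exp (2 * K1 * (\<tau> - s)) * m)"
  shows "norm I \<le> exp (2 * K1 * (t - s)) * m / 2"
proof -
  let ?h = "\<lambda>\<tau>. K1 * (exp (2 * K1 * \<tau> + - 2 * K1 * s) * m)"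
  have "(?h has_integral K1 * ((exp (2 * K1 * t + - 2 * K1 * s) - exp (2 * K1 * s + - 2 * K1 * s)) / (2 * K1) * m)) {s..t}"
    using K1_pos \<open>s \<le> t\<close>
    by (intro has_integral_mult_right has_integral_mult_left has_integral_exp_affine) auto
  moreover have "norm (expA e lam (t - \<tau>) (g \<tau>)) \<le> ?h \<tau>" if "\<tau> \<in> {s..t}" for \<tau>
    using bound[OF that] norm_expA_le[of "t - \<tau>" "g \<tau>"] that by (simp add: algebra_simps)
  ultimately have "norm I \<le> K1 * ((exp (2 * K1 * t + - 2 * K1 * s) - exp (2 * K1 * s + - 2 * K1 * s)) / (2 * K1) * m)"
    by (rule has_integral_norm_le[OF g])
  also have "\<dots> = (exp (2 * K1 * (t - s)) - 1) * m / 2"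
  proof -
    have "2 * K1 * t + - 2 * K1 * s = 2 * K1 * (t - s)" "2 * K1 * s + - 2 * K1 * s = 0"
      by (simp_all add: algebra_simps)
    then show ?thesis
      using K1_pos by (simp only: exp_zero) simp
  qed
  also have "\<dots> \<le> exp (2 * K1 * (t - s)) * m / 2"
    using \<open>0 \<le> m\<close> by (simp add: algebra_simps)
  finally show ?thesis .
qed

text \<open>In the norm weighted by \<open>exp(-2 K1 (\<tau> - s))\<close> the nonlinear integral operator has
  Lipschitz constant 1/2.\<close>
lemma solution_lipschitz:
  assumes u: "is_solution e lam F {s..t} u" and v: "is_solution e lam F {s..t} v" and "s \<le> t"
  shows "norm (u t - v t) \<le> 2 * exp (2 * K1 * (t - s)) * norm (u s - v s)"
proof -
  let ?w = "\<lambda>\<tau>. exp (- 2 * K1 * (\<tau> - s)) * norm (u \<tau> - v \<tau>)"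
  have "continuous_on {s..t} ?w"
    using u v unfolding is_solution_def by (intro continuous_intros) auto
  \<comment> \<open>At a maximum \<open>r\<close> of the weighted difference, the integral over
    \<open>{s..r}\<close> is at most half of \<open>norm (u r - v r)\<close> and is absorbed into
    the left side.\<close>
  then obtain r where r: "r \<in> {s..t}" and max: "\<And>\<tau>. \<tau> \<in> {s..t} \<Longrightarrow> ?w \<tau> \<le> ?w r"
    using continuous_attains_sup[of "{s..t}" ?w] \<open>s \<le> t\<close> by auto
  have w_eq: "norm (u \<tau> - v \<tau>) = exp (2 * K1 * (\<tau> - s)) * ?w \<tau>" for \<tau>
    by (simp add: mult.assoc[symmetric] flip: exp_add)
  have "((\<lambda>\<tau>. expA e lam (r - \<tau>) (F (u \<tau>) - F (v \<tau>))) has_integral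
      (u r - expA e lam (r - s) (u s)) - (v r - expA e lam (r - s) (v s))) {s..r}"
  proof (rule has_integral_eq)
    show "((\<lambda>\<tau>. expA e lam (r - \<tau>) (F (u \<tau>)) - expA e lam (r - \<tau>) (F (v \<tau>))) has_integral
      (u r - expA e lam (r - s) (u s)) - (v r - expA e lam (r - s) (v s))) {s..r}"
      using r by (intro has_integral_diff is_solutionD[OF u] is_solutionD[OF v]) auto
  qed (simp add: expA_diff)
  then have I: "((\<lambda>\<tau>. expA e lam (r - \<tau>) (F (u \<tau>) - F (v \<tau>))) has_integral
      (u r - v r) - expA e lam (r - s) (u s - v s)) {s..r}"
    using r by (simp add: expA_diff algebra_simps)
  have "norm ((u r - v r) - expA e lam (r - s) (u s - v s)) \<le> exp (2 * K1 * (r - s)) * ?w r / 2"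
  proof (rule K1_integral_le[OF I])
    fix \<tau> assume \<tau>: "\<tau> \<in> {s..r}"
    have "norm (F (u \<tau>) - F (v \<tau>)) \<le> K1 * (exp (2 * K1 * (\<tau> - s)) * ?w \<tau>)"
      using F_lip unfolding w_eq[symmetric] .
    also have "\<dots> \<le> K1 * (exp (2 * K1 * (\<tau> - s)) * ?w r)"
      using \<tau> r K1_pos by (intro mult_left_mono max) auto
    finally show "norm (F (u \<tau>) - F (v \<tau>)) \<le> K1 * (exp (2 * K1 * (\<tau> - s)) * ?w r)" .
  qed (use r in auto)
  then have "norm (u r - v r) \<le> norm (expA e lam (r - s) (u s - v s)) + norm (u r - v r) / 2"
    unfolding w_eq[symmetric]
    using norm_triangle_sub[of "u r - v r" "expA e lam (r - s) (u s - v s)"] by linarith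
  also have "norm (expA e lam (r - s) (u s - v s)) \<le> norm (u s - v s)"
    using r by (intro norm_expA_le) simp
  finally have ur: "norm (u r - v r) \<le> 2 * norm (u s - v s)"
    by simp
  have "?w t \<le> ?w r"
    using \<open>s \<le> t\<close> by (intro max) simp
  also have "\<dots> \<le> 1 * norm (u r - v r)"
    using r K1_pos by (intro mult_right_mono) auto
  finally have "?w t \<le> 2 * norm (u s - v s)"
    using ur by linarith
  then have "exp (2 * K1 * (t - s)) * ?w t \<le> exp (2 * K1 * (t - s)) * (2 * norm (u s - v s))"
    by (intro mult_left_mono) auto
  then show ?thesis
    unfolding w_eq[symmetric] by (simp add: algebra_simps)
qed

text \<open>Banach's fixed point theorem for the rescaled unknown
  \<open>v t = exp (- 2 * K1 * t) *\<^sub>R u t\<close>. The weight turns the Duhamel map into a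
  contraction on the whole half-line at once, with no gluing of short intervals.\<close>

lemma solution_exists: "\<exists>u. is_solution e lam F {0..} u \<and> u 0 = u0"
proof -
  let ?g = "\<lambda>(v :: real \<Rightarrow>\<^sub>C 'a) \<tau>. F (exp (2 * K1 * \<tau>) *\<^sub>R v \<tau>)"
  let ?U = "\<lambda>v t. expA e lam t u0 + mild_conv (?g v) t"
  \<comment> \<open>Using \<open>max 0 t\<close> extends the function by the constant
    \<open>u0\<close> to negative times, so that bounded continuous functions on all of the reals
    can serve as the complete space.\<close>
  define T where "T v t = exp (- 2 * K1 * max 0 t) *\<^sub>R ?U v (max 0 t)" for v t
  have g: "continuous_on S (?g v)" for v S
    by (intro continuous_on_F_compose continuous_intros) auto
  have U: "continuous_on {0..} (?U v)" for v
    by (intro continuous_intros continuous_on_expA continuous_on_mild_conv[OF g F_bound])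
  have "T v \<in> bcontfun" for v
  proof (rule bcontfun_normI)
    have "continuous_on UNIV (\<lambda>t. ?U v (max 0 t))"
      by (rule continuous_on_compose2[OF U]) (auto intro!: continuous_intros)
    then show "continuous_on UNIV (T v)"
      unfolding T_def by (intro continuous_on_scaleR) (auto intro!: continuous_intros)
    fix t
    have "norm (T v t) \<le> 1 * norm (?U v (max 0 t))"
      unfolding T_def norm_scaleR using K1_pos by (intro mult_right_mono) auto
    also have "\<dots> \<le> norm u0 + K0 / lam 0"
    proof -
      \<comment> \<open>\<open>Qproj e 0\<close> is the identity, so the tail estimate bounds the
        full norm, uniformly in time.\<close>
      have "norm (Qproj e 0 (mild_conv (?g v) (max 0 t))) \<le> K0 / lam 0"
        by (rule norm_Qproj_mild_conv_le[OF g F_bound]) simp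
      then show ?thesis
        using norm_expA_le[of "max 0 t" u0]
        by (simp add: norm_triangle_mono Qproj_def Pproj_def)
    qed
    finally show "norm (T v t) \<le> norm u0 + K0 / lam 0" .
  qed
  then have T_apply: "apply_bcontfun (Bcontfun (T v)) = T v" for v
    by (rule Bcontfun_inverse)
  have "dist (Bcontfun (T v)) (Bcontfun (T w)) \<le> (1/2) * dist v w" for v w
  proof (rule dist_bound)
    fix t0 :: real
    let ?t = "max 0 t0"
    have "((\<lambda>\<tau>. expA e lam (?t - \<tau>) (?g v \<tau> - ?g w \<tau>)) has_integral mild_conv (?g v) ?t - mild_conv (?g w) ?t) {0..?t}"
      by (rule has_integral_eq[OF _ has_integral_diff[OF has_integral_mild_conv[OF g] has_integral_mild_conv[OF g]]])
         (simp add: expA_diff)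
    then have "norm (mild_conv (?g v) ?t - mild_conv (?g w) ?t) \<le> exp (2 * K1 * (?t - 0)) * dist v w / 2"
    proof (rule K1_integral_le)
      fix \<tau> :: real
      have "norm (?g v \<tau> - ?g w \<tau>) \<le> K1 * norm (exp (2 * K1 * \<tau>) *\<^sub>R v \<tau> - exp (2 * K1 * \<tau>) *\<^sub>R w \<tau>)"
        by (rule F_lip)
      also have "\<dots> = K1 * (exp (2 * K1 * (\<tau> - 0)) * dist (v \<tau>) (w \<tau>))"
        by (simp add: dist_norm flip: scaleR_diff_right)
      also have "\<dots> \<le> K1 * (exp (2 * K1 * (\<tau> - 0)) * dist v w)"
        using K1_pos by (intro mult_left_mono dist_bounded) auto
      finally show "norm (?g v \<tau> - ?g w \<tau>) \<le> K1 * (exp (2 * K1 * (\<tau> - 0)) * dist v w)" .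
    qed auto
    then have "exp (- 2 * K1 * ?t) * norm (mild_conv (?g v) ?t - mild_conv (?g w) ?t)
        \<le> exp (- 2 * K1 * ?t) * (exp (2 * K1 * ?t) * (dist v w / 2))"
      by (intro mult_left_mono) auto
    also have "\<dots> = dist v w / 2"
      by (simp add: mult.assoc[symmetric] flip: exp_add)
    finally show "dist (Bcontfun (T v) t0) (Bcontfun (T w) t0) \<le> (1/2) * dist v w"
      by (simp add: T_apply T_def dist_norm flip: scaleR_diff_right)
  qed
  then obtain v where "Bcontfun (T v) = v"
    using banach_fix_type[of "1/2" "\<lambda>v. Bcontfun (T v)"] by auto
  then have v: "v t = T v t" for t
    by (metis T_apply)
  let ?u = "\<lambda>t. exp (2 * K1 * t) *\<^sub>R v t"
  have u: "?u t = ?U v t" if "0 \<le> t" for t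
    using that unfolding v[of t] by (simp add: T_def flip: exp_add)
  have "mild_conv (?g v) 0 = 0"
    unfolding mild_conv_def by simp
  then have u_0: "?u 0 = u0"
    using u[of 0] by (simp add: expA_0)
  have "is_solution e lam F {0..} ?u"
  proof (rule is_solutionI_coeff)
    show "continuous_on {0..} ?u"
      by (intro continuous_intros) auto
    fix t :: real and n assume "0 \<le> t"
    then show "?u t \<bullet> e n = exp (- lam n * t) *
        (?u 0 \<bullet> e n + integral {0..t} (\<lambda>\<tau>. exp (lam n * \<tau>) * (F (?u \<tau>) \<bullet> e n)))"
      unfolding u[OF \<open>0 \<le> t\<close>] u_0 by (simp add: inner_add_left coeff_expA coeff_mild_conv[OF g] distrib_left)
  qed
  with u_0 show ?thesis by blast
qed

section \<open>The flow and backward orbits\<close>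

abbreviation S :: "real \<Rightarrow> 'a \<Rightarrow> 'a" where
  "S \<equiv> flow e lam F"

lemma is_solution_cong:
  assumes "is_solution e lam F J u" and eq: "\<And>t. t \<in> J \<Longrightarrow> v t = u t"
    and J: "\<And>s t. s \<in> J \<Longrightarrow> t \<in> J \<Longrightarrow> {s..t} \<subseteq> J"
  shows "is_solution e lam F J v"
  unfolding is_solution_def
proof (intro conjI ballI impI)
  show "continuous_on J v"
    using assms(1) eq unfolding is_solution_def by (metis (no_types, lifting) continuous_on_cong)
  fix s t assume st: "s \<in> J" "t \<in> J" "s \<le> t"
  have "((\<lambda>\<tau>. expA e lam (t - \<tau>) (F (v \<tau>))) has_integral u t - expA e lam (t - s) (u s)) {s..t}"
    by (rule has_integral_eq[OF _ is_solutionD[OF assms(1) st]]) (use J[OF st(1,2)] eq in \<open>auto simp: subset_iff\<close>)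
  then show "((\<lambda>\<tau>. expA e lam (t - \<tau>) (F (v \<tau>))) has_integral v t - expA e lam (t - s) (v s)) {s..t}"
    using eq st by simp
qed

lemma is_solution_shift:
  assumes u: "is_solution e lam F J u" and J': "\<And>t. t \<in> J' \<Longrightarrow> t + a \<in> J"
  shows "is_solution e lam F J' (\<lambda>t. u (t + a))"
  unfolding is_solution_def
proof (intro conjI ballI impI)
  have "continuous_on J u"
    using u by (simp add: is_solution_def)
  then show "continuous_on J' (\<lambda>t. u (t + a))"
    by (rule continuous_on_compose2) (use J' in \<open>auto intro!: continuous_intros\<close>)
  fix s t assume st: "s \<in> J'" "t \<in> J'" "s \<le> t"
  have "((\<lambda>\<tau>. expA e lam (t + a - \<tau>) (F (u \<tau>))) has_integral u (t + a) - expA e lam (t + a - (s + a)) (u (s + a)))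
      (cbox (s + a) (t + a))"
    unfolding box_real using st J' by (intro is_solutionD[OF u]) auto
  from has_integral_affinity'[OF this zero_less_one, of a]
  show "((\<lambda>\<tau>. expA e lam (t - \<tau>) (F (u (\<tau> + a)))) has_integral
      u (t + a) - expA e lam (t - s) (u (s + a))) {s..t}"
    by (simp add: algebra_simps)
qed

text \<open>Two solutions with equal initial values coincide by \<open>solution_lipschitz\<close>,
  which makes the definite description in \<open>flow\<close> legitimate.\<close>

lemma flow_eq:
  assumes u: "is_solution e lam F {0..} u" and "0 \<le> t"
  shows "S t (u 0) = u t"
  unfolding flow_def
proof (rule the_equality)
  fix v assume "\<exists>w. is_solution e lam F {0..} w \<and> w 0 = u 0 \<and> w t = v"
  then obtain w where w: "is_solution e lam F {0..} w" "w 0 = u 0" "w t = v" by blast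
  have "norm (w t - u t) \<le> 2 * exp (2 * K1 * (t - 0)) * norm (w 0 - u 0)"
    using \<open>0 \<le> t\<close> by (intro solution_lipschitz is_solution_subset[OF w(1)] is_solution_subset[OF u]) auto
  then show "v = u t"
    using w by simp
qed (use u in blast)

lemma flow_0: "S 0 u0 = u0"
  using solution_exists[of u0] flow_eq[of _ 0] by auto

lemma is_solution_flow: "is_solution e lam F {0..} (\<lambda>t. S t u0)"
proof -
  obtain u where u: "is_solution e lam F {0..} u" "u 0 = u0"
    using solution_exists by blast
  show ?thesis
    by (rule is_solution_cong[OF u(1)]) (use flow_eq[OF u(1)] u(2) in auto)
qed

lemma flow_add:
  assumes "0 \<le> s" "0 \<le> t"
  shows "S (s + t) u = S s (S t u)"
  using flow_eq[OF is_solution_shift[OF is_solution_flow[of u], of "{0..}" t], of s] assms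
  by simp

lemma flow_lipschitz:
  assumes "0 \<le> t"
  shows "norm (S t u - S t v) \<le> 2 * exp (2 * K1 * t) * norm (u - v)"
  using solution_lipschitz[OF is_solution_subset[OF is_solution_flow[of u]] is_solution_subset[OF is_solution_flow[of v]], of 0 t]
    assms by (simp add: flow_0)

lemma tendsto_flow:
  assumes "0 \<le> t" "x \<longlonglongrightarrow> l"
  shows "(\<lambda>k. S t (x k)) \<longlonglongrightarrow> S t l"
proof (rule LIM_zero_cancel, rule Lim_null_comparison)
  show "\<forall>\<^sub>F k in sequentially. norm (S t (x k) - S t l) \<le> 2 * exp (2 * K1 * t) * norm (x k - l)"
    using flow_lipschitz[OF \<open>0 \<le> t\<close>] by simp
  show "(\<lambda>k. 2 * exp (2 * K1 * t) * norm (x k - l)) \<longlonglongrightarrow> 0"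
    by (intro tendsto_mult_right_zero tendsto_norm_zero LIM_zero assms)
qed

lemma flow_linear_part_le: "0 \<le> t \<Longrightarrow> norm (S t u - expA e lam t u) \<le> K0 * t"
  using solution_linear_part_le[OF is_solution_flow, of 0 t u] by (simp add: flow_0)

lemma flow_Qproj_le: "0 \<le> t \<Longrightarrow> norm (Qproj e M (S t u)) \<le> exp (- lam M * t) * norm (Qproj e M u) + K0 / lam M"
  using solution_Qproj_le[OF is_solution_flow, of 0 t M u] by (simp add: flow_0)

lemma flow_Pproj_le: "0 \<le> t \<Longrightarrow> norm (Pproj e M u) \<le> exp (lam M * t) * (norm (Pproj e M (S t u)) + K0 * t)"
  using solution_Pproj_le[OF is_solution_flow, of 0 t M u] by (simp add: flow_0)

lemma solution_eq_flow:
  assumes u: "is_solution e lam F J u" and "{s..t} \<subseteq> J" "s \<le> t"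
  shows "u t = S (t - s) (u s)"
proof -
  have "is_solution e lam F {0..t - s} (\<lambda>\<tau>. u (\<tau> + s))"
    by (rule is_solution_shift[OF u]) (use assms in auto)
  from solution_lipschitz[OF this is_solution_subset[OF is_solution_flow[of "u s"]]] \<open>s \<le> t\<close>
  show ?thesis by (simp add: flow_0)
qed

lemma is_solution_atMost:
  assumes u: "\<And>n :: nat. is_solution e lam F {- real n..0} u"
  shows "is_solution e lam F {..0} u"
  unfolding is_solution_def
proof (intro conjI ballI impI)
  show "continuous_on {..0} u"
    unfolding continuous_on_eq_continuous_within
  proof
    fix t :: real assume t: "t \<in> {..0}"
    obtain n :: nat where n: "- t < real n"
      using reals_Archimedean2 by blast
    have "at t within {..0} = at t within {- real n..0}"
      by (rule at_within_nhd[of t "{- real n<..}"]) (use n in auto)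
    then show "continuous (at t within {..0}) u"
      using u[of n] t n by (auto simp: is_solution_def continuous_on_eq_continuous_within)
  qed
  fix s t :: real assume st: "s \<in> {..0}" "t \<in> {..0}" "s \<le> t"
  obtain n :: nat where "- s < real n"
    using reals_Archimedean2 by blast
  then show "((\<lambda>\<tau>. expA e lam (t - \<tau>) (F (u \<tau>))) has_integral u t - expA e lam (t - s) (u s)) {s..t}"
    using st by (intro is_solutionD[OF u[of n]]) auto
qed

text \<open>A backward orbit sampled at the times \<open>0, -1, -2, \<dots>\<close>.\<close>
definition backward_orbit :: "(nat \<Rightarrow> 'a) \<Rightarrow> bool" where
  "backward_orbit a \<longleftrightarrow> (\<forall>n. S 1 (a (Suc n)) = a n)"

lemma backward_orbit_flow:
  assumes "backward_orbit a"
  shows "S (real m) (a (n + m)) = a n"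
proof (induction m)
  case (Suc m)
  have "S (real m + 1) (a (Suc (n + m))) = S (real m) (S 1 (a (Suc (n + m))))"
    by (rule flow_add) auto
  then show ?case
    using Suc assms by (simp add: backward_orbit_def add.commute)
qed (simp add: flow_0)

text \<open>Between samples the orbit is filled in by the flow. Any sample time
  \<open>- real n \<le> t\<close> gives the same value, so the pieces on
  \<open>{- real n..0}\<close> fit together.\<close>

lemma backward_orbit_solution:
  assumes a: "backward_orbit a"
  obtains u where "is_solution e lam F {..0} u"
    "\<And>n t. - real n \<le> t \<Longrightarrow> t \<le> 0 \<Longrightarrow> u t = S (t + real n) (a n)"
proof -
  \<comment> \<open>\<open>nat \<lceil>- t\<rceil>\<close> is the smallest \<open>n\<close> whose
    sample time \<open>- real n\<close> does not lie after \<open>t\<close>.\<close>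
  define u where "u t = S (t + real (nat \<lceil>- t\<rceil>)) (a (nat \<lceil>- t\<rceil>))" for t
  have u: "u t = S (t + real n) (a n)" if "- real n \<le> t" "t \<le> 0" for n t
  proof -
    define k where "k = nat \<lceil>- t\<rceil>"
    have "k \<le> n" "0 \<le> t + real k"
      using that unfolding k_def by linarith+
    then obtain m where m: "n = k + m"
      using le_Suc_ex by blast
    have "S ((t + real k) + real m) (a n) = S (t + real k) (S (real m) (a (k + m)))"
      unfolding m using \<open>0 \<le> t + real k\<close> by (intro flow_add) auto
    also have "\<dots> = u t"
      unfolding backward_orbit_flow[OF a] by (simp add: u_def k_def)
    finally show ?thesis by (simp add: m add.assoc)
  qed
  have "is_solution e lam F {- real n..0} u" for n
  proof (rule is_solution_cong)
    show "is_solution e lam F {- real n..0} (\<lambda>t. S (t + real n) (a n))"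
      by (rule is_solution_shift[OF is_solution_flow]) simp
  qed (use u in auto)
  then show ?thesis
    using u that is_solution_atMost by blast
qed

lemma bounded_Qproj_flow:
  assumes "bounded (range (\<lambda>n. Qproj e M (a n)))" and "0 \<le> t"
  shows "bounded (range (\<lambda>n. Qproj e M (S t (a n))))"
proof -
  obtain C where C: "\<And>n. norm (Qproj e M (a n)) \<le> C"
    using assms(1) unfolding bounded_iff by auto
  have "norm (Qproj e M (S t (a n))) \<le> C + K0 / lam M" for n
  proof -
    have "exp (- lam M * t) * norm (Qproj e M (a n)) \<le> 1 * C"
      using lam_pos[of M] \<open>0 \<le> t\<close> by (intro mult_mono C) auto
    then show ?thesis
      using flow_Qproj_le[OF \<open>0 \<le> t\<close>, of M "a n"] by simp
  qed
  then show ?thesis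
    unfolding bounded_iff by auto
qed

text \<open>Sampling loses nothing: between two samples the \<open>Q\<close>-part exceeds its
  earlier sampled bound by at most \<open>K0 / lam N\<close>. From here on only sequences are
  needed.\<close>

lemma Mminf_iff:
  "u0 \<in> Mminf e lam N F \<longleftrightarrow>
    (\<exists>a. a 0 = u0 \<and> backward_orbit a \<and> bounded (range (\<lambda>n. Qproj e N (a n))))" (is "_ \<longleftrightarrow> ?R")
proof
  assume "u0 \<in> Mminf e lam N F"
  then obtain u where u: "is_solution e lam F {..0} u" "u 0 = u0"
    and bdd: "bounded ((\<lambda>t. Qproj e N (u t)) ` {..0})"
    unfolding Mminf_def by blast
  let ?a = "\<lambda>n. u (- real n)"
  have "S 1 (?a (Suc n)) = ?a n" for n
    using solution_eq_flow[OF u(1), of "- real (Suc n)" "- real n"] by simp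
  moreover have "bounded (range (\<lambda>n. Qproj e N (?a n)))"
    by (rule bounded_subset[OF bdd]) auto
  ultimately show ?R
    using u(2) by (intro exI[of _ ?a]) (simp add: backward_orbit_def)
next
  assume ?R
  then obtain a where a: "a 0 = u0" "backward_orbit a" and bdd: "bounded (range (\<lambda>n. Qproj e N (a n)))"
    by blast
  obtain C where C: "\<And>n. norm (Qproj e N (a n)) \<le> C"
    using bdd unfolding bounded_iff by auto
  obtain u where u: "is_solution e lam F {..0} u"
    and flow: "\<And>n t. - real n \<le> t \<Longrightarrow> t \<le> 0 \<Longrightarrow> u t = S (t + real n) (a n)"
    using backward_orbit_solution[OF a(2)] by metis
  have "norm (Qproj e N (u t)) \<le> C + K0 / lam N" if "t \<le> 0" for t
  proof -
    obtain n :: nat where n: "- t < real n"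
      using reals_Archimedean2 by blast
    have "norm (Qproj e N (u t)) \<le> exp (- lam N * (t + real n)) * norm (Qproj e N (a n)) + K0 / lam N"
      using n that flow[of n t] flow_Qproj_le[of "t + real n" N "a n"] by simp
    also have "exp (- lam N * (t + real n)) * norm (Qproj e N (a n)) \<le> 1 * norm (Qproj e N (a n))"
      using n lam_pos[of N] by (intro mult_right_mono) auto
    finally show ?thesis using C[of n] by simp
  qed
  then have "bounded ((\<lambda>t. Qproj e N (u t)) ` {..0})"
    unfolding bounded_iff by auto
  moreover have "u 0 = u0"
    using flow[of 0 0] a(1) by (simp add: flow_0)
  ultimately show "u0 \<in> Mminf e lam N F"
    using u unfolding Mminf_def by blast
qed

text \<open>Start \<open>m\<close> steps further back: the contribution of that state is at most
  \<open>exp (- lam M * m) * C\<close> and vanishes as \<open>m\<close> grows. The orbit's own bound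
  \<open>C\<close> drops out, which makes the estimate uniform over all such orbits.\<close>

lemma backward_orbit_Qproj_le:
  assumes a: "backward_orbit a" and bdd: "bounded (range (\<lambda>n. Qproj e N (a n)))" and "N \<le> M"
  shows "norm (Qproj e M (a n)) \<le> K0 / lam M"
proof -
  obtain C where C: "\<And>n. norm (Qproj e N (a n)) \<le> C"
    using bdd unfolding bounded_iff by auto
  have "norm (Qproj e M (a n)) \<le> exp (- lam M * real m) * C + K0 / lam M" for m
  proof -
    have "norm (Qproj e M (a n)) \<le> exp (- lam M * real m) * norm (Qproj e M (a (n + m))) + K0 / lam M"
      using flow_Qproj_le[of "real m" M "a (n + m)"] backward_orbit_flow[OF a] by simp
    also have "norm (Qproj e M (a (n + m))) \<le> C"
      using norm_Qproj_antimono[OF \<open>N \<le> M\<close>] C order_trans by blast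
    finally show ?thesis by simp
  qed
  moreover have "(\<lambda>m. exp (- lam M * real m) * C + K0 / lam M) \<longlonglongrightarrow> 0 * C + K0 / lam M"
  proof (intro tendsto_intros)
    have "(\<lambda>m. exp (- lam M) ^ m) \<longlonglongrightarrow> 0"
      using lam_pos[of M] by (intro LIMSEQ_power_zero) simp
    then show "(\<lambda>m. exp (- lam M * real m)) \<longlonglongrightarrow> 0"
      by (simp flip: exp_of_nat2_mult)
  qed
  ultimately show ?thesis
    using LIMSEQ_le_const by fastforce
qed

section \<open>Limits of backward orbits\<close>

text \<open>The orbit relation is required only eventually in \<open>k\<close> for each
  \<open>n\<close>, because it will be applied to orbits with a finite past whose length grows with
  \<open>k\<close>.\<close>

lemma backward_orbit_limit:
  assumes K: "\<And>n. compact (K n)" "\<And>k n. x k n \<in> K n"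
    and orbit: "\<And>n. \<forall>\<^sub>F k in sequentially. S 1 (x k (Suc n)) = x k n"
  obtains l r where "strict_mono r" "\<And>n. (\<lambda>k. x (r k) n) \<longlonglongrightarrow> l n" "\<And>n. l n \<in> K n" "backward_orbit l"
proof -
  obtain l r where r: "strict_mono r" and l: "\<And>n. (\<lambda>k. x (r k) n) \<longlonglongrightarrow> l n" "\<And>n. l n \<in> K n"
    by (rule compact_sequences_coordinatewise[of K x, OF K]) (rule that)
  have "S 1 (l (Suc n)) = l n" for n
  proof (rule LIMSEQ_unique)
    show "(\<lambda>k. S 1 (x (r k) (Suc n))) \<longlonglongrightarrow> S 1 (l (Suc n))"
      by (intro tendsto_flow l) simp
    have "\<forall>\<^sub>F k in sequentially. S 1 (x (r k) (Suc n)) = x (r k) n"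
      using eventually_subseq[OF r orbit[of n]] .
    then show "(\<lambda>k. S 1 (x (r k) (Suc n))) \<longlonglongrightarrow> l n"
      using l(1)[of n] by (simp add: tendsto_cong)
  qed
  then show ?thesis
    using that[OF r l] by (simp add: backward_orbit_def)
qed

text \<open>A compact set containing the time \<open>-n\<close> state of every backward orbit with bounded
  \<open>Q\<close>-part whose final state has \<open>P\<close>-part of norm at most \<open>c\<close>.\<close>
definition backward_set :: "nat \<Rightarrow> real \<Rightarrow> nat \<Rightarrow> 'a set" where
  "backward_set N c n = {u. norm u \<le> exp (lam N * n) * (c + K0 * n) + K0 / lam N \<and>
     (\<forall>M\<ge>N. norm (Qproj e M u) \<le> K0 / lam M)}"

lemma compact_backward_set: "compact (backward_set N c n)"
  unfolding backward_set_def
proof (rule compact_tail_set)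
  show "(\<lambda>M. K0 / lam M) \<longlonglongrightarrow> 0"
    by (rule tendsto_divide_0[OF tendsto_const filterlim_mono[OF lam_infty at_top_le_at_infinity order_refl]])
qed

lemma backward_setI:
  assumes P: "norm (Pproj e N (S (real n) u)) \<le> c"
    and Q: "\<And>M. N \<le> M \<Longrightarrow> norm (Qproj e M u) \<le> K0 / lam M"
  shows "u \<in> backward_set N c n"
proof -
  have "norm (Pproj e N u) \<le> exp (lam N * real n) * (norm (Pproj e N (S (real n) u)) + K0 * real n)"
    by (rule flow_Pproj_le) simp
  also have "\<dots> \<le> exp (lam N * n) * (c + K0 * n)"
    using P by (intro mult_left_mono) auto
  finally have "norm (Pproj e N u + Qproj e N u) \<le> exp (lam N * n) * (c + K0 * n) + K0 / lam N"
    using Q[of N] by (intro norm_triangle_mono) auto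
  then show ?thesis
    using Q by (simp add: backward_set_def Pproj_plus_Qproj)
qed

lemma zero_in_backward_set: "0 \<le> c \<Longrightarrow> 0 \<in> backward_set N c n"
  using K0_nonneg lam_pos
  by (simp add: backward_set_def linear_0[OF bounded_linear.linear[OF bounded_linear_Qproj]]
      divide_nonneg_pos)

text \<open>The norm bound in \<open>backward_set\<close> grows with \<open>n\<close>, but the bound
  on the \<open>Q\<close>-part does not.\<close>

lemma Mminf_if_backward_set:
  assumes "backward_orbit l" "\<And>n. l n \<in> backward_set N c n"
  shows "l 0 \<in> Mminf e lam N F"
proof -
  have "bounded (range (\<lambda>n. Qproj e N (l n)))"
    unfolding bounded_iff using assms(2) by (auto simp: backward_set_def)
  then show ?thesis
    using assms(1) Mminf_iff by blast
qed

text \<open>\<open>P S(T)\<close> on \<open>PH\<close> differs from the expanding-in-backward-time linear map \<open>exp(-AT)\<close> by a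
  bounded perturbation, so the signs on opposite faces of a large cube are opposite.\<close>
lemma Pproj_flow_almost_surj:
  assumes p: "Pproj e N p = p" and "0 \<le> T" "0 < \<epsilon>"
  shows "\<exists>u. Pproj e N u = u \<and> norm (Pproj e N (S T u) - p) \<le> \<epsilon>"
proof -
  define q :: "(nat \<Rightarrow> real) \<Rightarrow> 'a" where "q x = (\<Sum>j<N. x j *\<^sub>R e j)" for x
  have coeff_q: "q x \<bullet> e i = (if i < N then x i else 0)" for x i
    unfolding q_def by (subst coeff_sum) auto
  define g where "g x i = (S T (q x) - p) \<bullet> e i" for x i
  \<comment> \<open>\<open>L\<close> beats the perturbation: after contraction by
    \<open>exp (- lam i * T)\<close> it still exceeds \<open>K0 * T + norm p\<close>. The tolerance
    \<open>\<eta>\<close> leaves a total error of at most \<open>\<epsilon>\<close> over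
    \<open>N\<close> coordinates, and \<open>C\<close> is a Lipschitz constant of \<open>g\<close>
    in the maximum norm; the \<open>+ 1\<close> covers \<open>N = 0\<close>.\<close>
  define L where "L = exp (lam N * T) * (K0 * T + norm p + 1)"
  define \<eta> where "\<eta> = \<epsilon> / (real N + 1)"
  define C where "C = 2 * exp (2 * K1 * T) * (real N + 1)"
  have pos: "0 < L" "0 < \<eta>" "0 < C"
    using K0_nonneg assms by (auto simp: L_def \<eta>_def C_def intro!: mult_pos_pos add_nonneg_pos)
  have linear: "\<bar>S T u \<bullet> e i - exp (- lam i * T) * (u \<bullet> e i)\<bar> \<le> K0 * T" for u i
    using abs_coeff_le[of "S T u - expA e lam T u" i] flow_linear_part_le[OF \<open>0 \<le> T\<close>, of u] \<open>0 \<le> T\<close>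
    by (simp add: inner_diff_left coeff_expA)
  have L: "K0 * T + norm p \<le> exp (- lam i * T) * L" if "i < N" for i
  proof -
    have "1 \<le> exp (- lam i * T) * exp (lam N * T)"
      using that \<open>0 \<le> T\<close> monoD[OF lam_mono, of i N] by (simp add: mult_right_mono flip: exp_add)
    then have "1 * (K0 * T + norm p + 1) \<le> exp (- lam i * T) * exp (lam N * T) * (K0 * T + norm p + 1)"
      using K0_nonneg \<open>0 \<le> T\<close> by (intro mult_right_mono) auto
    then show ?thesis
      by (simp add: L_def mult.assoc)
  qed
  have "\<exists>x. (\<forall>j<N. \<bar>x j\<bar> \<le> L) \<and> (\<forall>i<N. \<bar>g x i\<bar> \<le> \<eta>)"
  proof (rule poincare_miranda_approx)
    show "\<exists>\<delta>>0. \<forall>x y. (\<forall>j<N. \<bar>x j\<bar> \<le> L \<and> \<bar>y j\<bar> \<le> L \<and> \<bar>x j - y j\<bar> \<le> \<delta>) \<longrightarrow> (\<forall>i<N. \<bar>g x i - g y i\<bar> \<le> \<eta>)"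
    proof (intro exI[of _ "\<eta> / C"] conjI allI impI)
      fix x y i assume close: "\<forall>j<N. \<bar>x j\<bar> \<le> L \<and> \<bar>y j\<bar> \<le> L \<and> \<bar>x j - y j\<bar> \<le> \<eta> / C"
      have "norm (q x - q y) = norm (\<Sum>j<N. (x j - y j) *\<^sub>R e j)"
        by (simp add: q_def sum_subtractf scaleR_diff_left)
      also have "\<dots> \<le> real N * (\<eta> / C)"
        using sum_norm_bound[of "{..<N}" "\<lambda>j. (x j - y j) *\<^sub>R e j" "\<eta> / C"] close
        by (simp add: norm_eq_sqrt_inner[of "e _"] orthonormal)
      also have "\<dots> \<le> (real N + 1) * (\<eta> / C)"
        using pos by (intro mult_right_mono) auto
      finally have q_diff: "norm (q x - q y) \<le> (real N + 1) * (\<eta> / C)" .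
      have "\<bar>g x i - g y i\<bar> = \<bar>(S T (q x) - S T (q y)) \<bullet> e i\<bar>"
        by (simp add: g_def inner_diff_left)
      also have "\<dots> \<le> 2 * exp (2 * K1 * T) * norm (q x - q y)"
        using abs_coeff_le flow_lipschitz[OF \<open>0 \<le> T\<close>] order_trans by blast
      also have "\<dots> \<le> 2 * exp (2 * K1 * T) * ((real N + 1) * (\<eta> / C))"
        using q_diff by (intro mult_left_mono) auto
      also have "\<dots> = C * (\<eta> / C)"
        by (simp add: C_def)
      finally show "\<bar>g x i - g y i\<bar> \<le> \<eta>"
        using pos by simp
    qed (use pos in auto)
    fix x i assume "i < N"
    show "g x i \<le> 0" if "x i = - L"
      using linear[of "q x" i] L[OF \<open>i < N\<close>] abs_coeff_le[of p i] \<open>i < N\<close> that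
      by (simp add: g_def inner_diff_left coeff_q abs_le_iff)
    show "0 \<le> g x i" if "x i = L"
      using linear[of "q x" i] L[OF \<open>i < N\<close>] abs_coeff_le[of p i] \<open>i < N\<close> that
      by (simp add: g_def inner_diff_left coeff_q abs_le_iff)
  qed (use pos in auto)
  then obtain x where x: "\<And>i. i < N \<Longrightarrow> \<bar>g x i\<bar> \<le> \<eta>"
    by blast
  have "Pproj e N (S T (q x)) - p = (\<Sum>i<N. g x i *\<^sub>R e i)"
    by (subst p[symmetric]) (simp add: g_def Pproj_def inner_diff_left scaleR_diff_left sum_subtractf)
  also have "norm \<dots> \<le> real N * \<eta>"
    using sum_norm_bound[of "{..<N}" "\<lambda>i. g x i *\<^sub>R e i" \<eta>] x
    by (simp add: norm_eq_sqrt_inner[of "e _"] orthonormal)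
  also have "\<dots> \<le> (real N + 1) * \<eta>"
    using pos by (intro mult_right_mono) auto
  also have "\<dots> = \<epsilon>"
    by (simp add: \<eta>_def)
  finally have "norm (Pproj e N (S T (q x)) - p) \<le> \<epsilon>" .
  moreover have "Pproj e N (q x) = q x"
    by (rule coeff_eqI) (simp add: coeff_Pproj coeff_q)
  ultimately show ?thesis by blast
qed

lemma Mminf_over_nonempty:
  assumes p: "Pproj e N p = p"
  shows "\<exists>u\<in>Mminf e lam N F. Pproj e N u = p"
proof -
  have "\<exists>v. \<forall>k. Pproj e N (v k) = v k \<and> norm (Pproj e N (S (real k) (v k)) - p) \<le> 1 / real (Suc k)"
    by (intro choice allI Pproj_flow_almost_surj p) auto
  then obtain v where v: "\<And>k. Pproj e N (v k) = v k"
    and near: "\<And>k. norm (Pproj e N (S (real k) (v k)) - p) \<le> 1 / real (Suc k)"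
    by blast
  \<comment> \<open>\<open>x k n\<close> is the state at time \<open>-n\<close> of the orbit started
    at time \<open>-k\<close> on \<open>PH\<close>. Times before the start are padded with 0, which
    lies in the compact sets.\<close>
  define x where "x k n = (if n \<le> k then S (real (k - n)) (v k) else 0)" for k n
  have mem: "x k n \<in> backward_set N (norm p + 1) n" for k n
  proof (cases "n \<le> k")
    case True
    have "S (real n) (x k n) = S (real k) (v k)"
      using flow_add[of "real n" "real (k - n)" "v k"] True by (simp add: x_def of_nat_diff)
    moreover have "norm (Pproj e N (S (real k) (v k))) \<le> norm p + 1"
    proof -
      have "1 / real (Suc k) \<le> 1" by simp
      then show ?thesis
        using near[of k] norm_triangle_sub[of "Pproj e N (S (real k) (v k))" p] by linarith
    qed
    \<comment> \<open>The starting point \<open>v k\<close> has no component in \<open>QH\<close>,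
      so the decaying term in \<open>flow_Qproj_le\<close> is exactly zero.\<close>
    moreover have "norm (Qproj e M (x k n)) \<le> K0 / lam M" if "N \<le> M" for M
      using flow_Qproj_le[of "real (k - n)" M "v k"] Qproj_Pproj[OF that, of "v k"] True
      by (simp add: x_def v)
    ultimately show ?thesis
      by (intro backward_setI) auto
  next
    case False
    then show ?thesis
      by (simp add: x_def zero_in_backward_set)
  qed
  have orbit: "\<forall>\<^sub>F k in sequentially. S 1 (x k (Suc n)) = x k n" for n
    unfolding eventually_sequentially
  proof (intro exI[of _ "Suc n"] allI impI)
    fix k assume "Suc n \<le> k"
    then show "S 1 (x k (Suc n)) = x k n"
      using flow_add[of 1 "real (k - Suc n)" "v k"] by (simp add: x_def of_nat_diff)
  qed
  obtain l r where r: "strict_mono r" and l: "\<And>n. (\<lambda>k. x (r k) n) \<longlonglongrightarrow> l n"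
    and mem_l: "\<And>n. l n \<in> backward_set N (norm p + 1) n" and "backward_orbit l"
    by (rule backward_orbit_limit[of "backward_set N (norm p + 1)" x, OF compact_backward_set mem orbit]) (rule that)
  have "Pproj e N (l 0) = p"
  proof (rule LIMSEQ_unique)
    show "(\<lambda>k. Pproj e N (x (r k) 0)) \<longlonglongrightarrow> Pproj e N (l 0)"
      by (rule bounded_linear.tendsto[OF bounded_linear_Pproj l])
    have "(\<lambda>k. Pproj e N (x k 0)) \<longlonglongrightarrow> p"
    proof (rule LIM_zero_cancel, rule Lim_null_comparison)
      show "\<forall>\<^sub>F k in sequentially. norm (Pproj e N (x k 0) - p) \<le> 1 / real (Suc k)"
        using near by (simp add: x_def)
    qed (rule LIMSEQ_Suc[OF lim_1_over_n])
    then show "(\<lambda>k. Pproj e N (x (r k) 0)) \<longlonglongrightarrow> p"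
      using LIMSEQ_subseq_LIMSEQ[OF _ r] by (force simp: o_def)
  qed
  then show ?thesis
    using Mminf_if_backward_set[OF \<open>backward_orbit l\<close> mem_l] by blast
qed

text \<open>Convergent \<open>P\<close>-parts are bounded, so all the backward orbits lie in one
  product of compact sets. In effect \<open>Mminf\<close> is closed and the projection
  \<open>Pproj e N\<close> is proper on it.\<close>

lemma Mminf_limit:
  assumes u: "\<And>k. u k \<in> Mminf e lam N F" and lim: "(\<lambda>k. Pproj e N (u k)) \<longlonglongrightarrow> p"
  obtains l r where "strict_mono r" "(\<lambda>k. u (r k)) \<longlonglongrightarrow> l" "l \<in> Mminf e lam N F"
proof -
  obtain a where a: "\<And>k. a k 0 = u k" "\<And>k. backward_orbit (a k)"
    and bdd: "\<And>k. bounded (range (\<lambda>n. Qproj e N (a k n)))"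
    using u unfolding Mminf_iff by metis
  have "Bseq (\<lambda>k. Pproj e N (u k))"
    using lim by (intro convergent_imp_Bseq) (auto simp: convergent_def)
  then obtain c where c: "\<And>k. norm (Pproj e N (u k)) \<le> c"
    by (auto simp: Bseq_def)
  have mem: "a k n \<in> backward_set N c n" for k n
    using backward_orbit_flow[OF a(2), of n k 0] c[of k] a(1)
    by (intro backward_setI backward_orbit_Qproj_le[OF a(2) bdd]) auto
  have orbit: "\<forall>\<^sub>F k in sequentially. S 1 (a k (Suc n)) = a k n" for n
    using a(2) by (simp add: backward_orbit_def)
  obtain l r where r: "strict_mono r" and l: "\<And>n. (\<lambda>k. a (r k) n) \<longlonglongrightarrow> l n"
    and mem_l: "\<And>n. l n \<in> backward_set N c n" and orbit_l: "backward_orbit l"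
    by (rule backward_orbit_limit[of "backward_set N c" a, OF compact_backward_set mem orbit]) (rule that)
  show ?thesis
  proof (rule that[OF r])
    show "(\<lambda>k. u (r k)) \<longlonglongrightarrow> l 0"
      using l[of 0] by (simp add: a(1))
    show "l 0 \<in> Mminf e lam N F"
      by (rule Mminf_if_backward_set[OF orbit_l mem_l])
  qed
qed

section \<open>The set-valued map and its upper hemicontinuity\<close>

lemma Phi_iff:
  "q \<in> Phi e lam N F p \<longleftrightarrow> Qproj e N q = q \<and> p + q \<in> Mminf e lam N F"
proof -
  have "q \<in> range (Qproj e N) \<longleftrightarrow> Qproj e N q = q"
    by (metis Qproj_idem rangeE rangeI)
  then show ?thesis by (simp add: Phi_def)
qed

lemma Pproj_range_iff: "p \<in> range (Pproj e N) \<longleftrightarrow> Pproj e N p = p"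
  by (metis Pproj_idem rangeE rangeI)

lemma Pproj_Qproj_add:
  assumes "Pproj e N p = p" "Qproj e N q = q"
  shows "Pproj e N (p + q) = p" "Qproj e N (p + q) = q"
proof -
  have "Pproj e N q = 0"
    by (metis assms(2) Pproj_Qproj)
  then show "Pproj e N (p + q) = p"
    using assms(1) by (simp add: linear_add[OF bounded_linear.linear[OF bounded_linear_Pproj]])
  then show "Qproj e N (p + q) = q"
    by (simp add: Qproj_def)
qed

lemma Phi_nonempty:
  assumes "p \<in> range (Pproj e N)"
  shows "Phi e lam N F p \<noteq> {}"
proof -
  obtain u where "u \<in> Mminf e lam N F" "Pproj e N u = p"
    using Mminf_over_nonempty assms Pproj_range_iff by blast
  then have "Qproj e N u \<in> Phi e lam N F p"
    using Pproj_plus_Qproj[of N u] by (simp add: Phi_iff Qproj_idem)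
  then show ?thesis by blast
qed

text \<open>A failure at \<open>p\<close> yields points of the graph over \<open>p' k\<close>
  tending to \<open>p\<close> whose \<open>Q\<close>-parts avoid \<open>U\<close>. By
  \<open>Mminf_limit\<close> a subsequence converges to a point of the graph over \<open>p\<close>,
  whose \<open>Q\<close>-part lies in the open set \<open>U\<close>.\<close>

lemma upper_hemicontinuous_Phi: "upper_hemicontinuous_on (range (Pproj e N)) (Phi e lam N F)"
  unfolding upper_hemicontinuous_on_def
proof (intro ballI allI impI, rule ccontr)
  fix p U assume p: "p \<in> range (Pproj e N)" and U: "open U \<and> Phi e lam N F p \<subseteq> U"
    and contra: "\<nexists>V. open V \<and> p \<in> V \<and> (\<forall>p'\<in>V \<inter> range (Pproj e N). Phi e lam N F p' \<subseteq> U)"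
  have "\<exists>p' q. p' \<in> ball p (1 / real (Suc k)) \<and> p' \<in> range (Pproj e N) \<and> q \<in> Phi e lam N F p' \<and> q \<notin> U" for k
    using contra[simplified, rule_format, of "ball p (1 / real (Suc k))"] by fastforce
  then obtain p' q where p': "\<And>k. p' k \<in> ball p (1 / real (Suc k))" "\<And>k. Pproj e N (p' k) = p' k"
    and q: "\<And>k. q k \<in> Phi e lam N F (p' k)" "\<And>k. q k \<notin> U"
    unfolding Pproj_range_iff by metis
  let ?u = "\<lambda>k. p' k + q k"
  have PQ: "Pproj e N (?u k) = p' k" "Qproj e N (?u k) = q k" for k
    using Pproj_Qproj_add p'(2) q(1) unfolding Phi_iff by blast+
  have p'_lim: "p' \<longlonglongrightarrow> p"
  proof (rule LIM_zero_cancel, rule Lim_null_comparison)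
    show "\<forall>\<^sub>F k in sequentially. norm (p' k - p) \<le> 1 / real (Suc k)"
      using p'(1) by (simp add: dist_norm norm_minus_commute less_imp_le)
  qed (rule LIMSEQ_Suc[OF lim_1_over_n])
  then obtain l r where r: "strict_mono r" and l: "(\<lambda>k. ?u (r k)) \<longlonglongrightarrow> l" "l \<in> Mminf e lam N F"
    using Mminf_limit[of ?u N p] q(1) unfolding Phi_iff PQ by blast
  have "(\<lambda>k. p' (r k)) \<longlonglongrightarrow> Pproj e N l"
    using bounded_linear.tendsto[OF bounded_linear_Pproj[of N] l(1)] by (simp add: PQ)
  moreover have "(\<lambda>k. p' (r k)) \<longlonglongrightarrow> p"
    using LIMSEQ_subseq_LIMSEQ[OF p'_lim r] by (simp add: o_def)
  ultimately have "Pproj e N l = p"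
    by (rule LIMSEQ_unique)
  then have "Qproj e N l \<in> U"
    using l(2) U Pproj_plus_Qproj[of N l] by (auto simp: Phi_iff Qproj_idem)
  moreover have "(\<lambda>k. q (r k)) \<longlonglongrightarrow> Qproj e N l"
    using bounded_linear.tendsto[OF bounded_linear_Qproj[of N] l(1)] by (simp add: PQ)
  ultimately have "\<forall>\<^sub>F k in sequentially. q (r k) \<in> U"
    using U topological_tendstoD by blast
  then show False
    using q(2) by (simp add: eventually_sequentially)
qed

lemma Mminf_eq_graph:
  "Mminf e lam N F = {p + q | p q. p \<in> range (Pproj e N) \<and> q \<in> Phi e lam N F p}"
proof (intro equalityI subsetI)
  fix u assume "u \<in> Mminf e lam N F"
  then have "Qproj e N u \<in> Phi e lam N F (Pproj e N u)"
    by (simp add: Phi_iff Qproj_idem Pproj_plus_Qproj)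
  then show "u \<in> {p + q | p q. p \<in> range (Pproj e N) \<and> q \<in> Phi e lam N F p}"
    using Pproj_plus_Qproj[of N u, symmetric] by blast
qed (auto simp: Phi_iff)

section \<open>Invariance under the flow, and the global attractor\<close>

lemma Mminf_invariant:
  assumes "0 \<le> t"
  shows "S t ` Mminf e lam N F = Mminf e lam N F"
proof (intro equalityI subsetI)
  fix w assume "w \<in> S t ` Mminf e lam N F"
  then obtain v where "w = S t v" "v \<in> Mminf e lam N F"
    by blast
  then obtain a where a: "w = S t (a 0)" "backward_orbit a" and bdd: "bounded (range (\<lambda>n. Qproj e N (a n)))"
    unfolding Mminf_iff by blast
  let ?b = "\<lambda>n. S t (a n)"
  have "S 1 (?b (Suc n)) = ?b n" for n
    using flow_add[of 1 t "a (Suc n)"] flow_add[of t 1 "a (Suc n)"] a(2) assms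
    by (simp add: backward_orbit_def add.commute)
  moreover have "bounded (range (\<lambda>n. Qproj e N (?b n)))"
    by (rule bounded_Qproj_flow[OF bdd assms])
  ultimately show "w \<in> Mminf e lam N F"
    unfolding Mminf_iff using a(1) by (intro exI[of _ ?b]) (simp add: backward_orbit_def)
next
  fix w assume "w \<in> Mminf e lam N F"
  then obtain a where a: "w = a 0" "backward_orbit a" and bdd: "bounded (range (\<lambda>n. Qproj e N (a n)))"
    unfolding Mminf_iff by blast
  obtain m :: nat where m: "t \<le> real m"
    using real_arch_simple by blast
  \<comment> \<open>The samples have integer spacing but \<open>t\<close> is arbitrary: going back
    \<open>m \<ge> t\<close> steps and then forward by \<open>m - t\<close> gives the orbit shifted
    back by exactly \<open>t\<close>.\<close>
  let ?b = "\<lambda>n. S (real m - t) (a (n + m))"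
  have "S 1 (?b (Suc n)) = ?b n" for n
    using flow_add[of 1 "real m - t" "a (Suc n + m)"] flow_add[of "real m - t" 1 "a (Suc n + m)"] a(2) m
    by (simp add: backward_orbit_def add.commute)
  moreover have "bounded (range (\<lambda>n. Qproj e N (?b n)))"
    using m by (intro bounded_Qproj_flow bounded_subset[OF bdd]) auto
  ultimately have "?b 0 \<in> Mminf e lam N F"
    unfolding Mminf_iff by (intro exI[of _ ?b]) (simp add: backward_orbit_def)
  moreover have "w = S t (?b 0)"
    using flow_add[of t "real m - t" "a m"] backward_orbit_flow[OF a(2), of m 0] assms m a(1) by simp
  ultimately show "w \<in> S t ` Mminf e lam N F"
    by blast
qed

text \<open>Invariance supplies a preimage under \<open>S 1\<close> inside \<open>A\<close> for
  every point of \<open>A\<close>; iterating a choice of preimages produces a backward orbit that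
  never leaves the bounded set.\<close>

lemma bounded_invariant_subset_Mminf:
  assumes "bounded A" and inv: "S 1 ` A = A"
  shows "A \<subseteq> Mminf e lam N F"
proof
  fix u assume "u \<in> A"
  have "\<forall>x\<in>A. \<exists>y. y \<in> A \<and> S 1 y = x"
  proof
    fix x assume "x \<in> A"
    then have "x \<in> S 1 ` A" by (simp only: inv)
    then show "\<exists>y. y \<in> A \<and> S 1 y = x" by blast
  qed
  from bchoice[OF this] obtain pre where pre: "\<forall>x\<in>A. pre x \<in> A \<and> S 1 (pre x) = x" ..
  let ?a = "\<lambda>n. (pre ^^ n) u"
  have mem: "?a n \<in> A" for n
    using \<open>u \<in> A\<close> pre by (induction n) auto
  then have "backward_orbit ?a"
    using pre by (simp add: backward_orbit_def)
  moreover have "bounded (range (\<lambda>n. Qproj e N (?a n)))"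
  proof (rule bounded_subset)
    show "bounded (Qproj e N ` A)"
      by (rule bounded_linear_image[OF \<open>bounded A\<close> bounded_linear_Qproj])
  qed (use mem in auto)
  ultimately show "u \<in> Mminf e lam N F"
    unfolding Mminf_iff by (intro exI[of _ ?a]) simp
qed

end

theorem theorem4p2:
  fixes e :: "nat \<Rightarrow> 'a::{real_inner, complete_space}"
    and lam :: "nat \<Rightarrow> real"
    and N :: nat
    and F :: "'a \<Rightarrow> 'a"
    and K0 K1 R :: real
  assumes orthonormal: "\<And>m n. e m \<bullet> e n = (if m = n then 1 else 0)"
    and complete: "\<And>u. (\<lambda>n. (u \<bullet> e n) *\<^sub>R e n) sums u"
    and lam_pos: "0 < lam 0"
    and lam_01: "lam 0 < lam 1"
    and lam_mono: "mono lam"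
    and lam_infty: "filterlim lam at_top sequentially"
    and N_pos: "1 \<le> N"
    and gap: "lam (N - 1) < lam N"
    and K0_pos: "0 < K0" and K1_pos: "0 < K1"
    and F_bound: "\<And>u. norm (F u) \<le> K0"
    and F_lip: "\<And>u v. norm (F u - F v) \<le> K1 * norm (u - v)"
    and K1_lt: "K1 < lam N"
    and R_pos: "0 < R"
    and F_supp: "\<And>u. R \<le> norm u \<Longrightarrow> F u = 0"
  shows "(\<forall>p0\<in>range (Pproj e N). Phi e lam N F p0 \<noteq> {})
     \<and> upper_hemicontinuous_on (range (Pproj e N)) (Phi e lam N F)
     \<and> Mminf e lam N F = {p0 + q0 | p0 q0. p0 \<in> range (Pproj e N) \<and> q0 \<in> Phi e lam N F p0}
     \<and> (\<forall>t\<ge>0. flow e lam F t ` Mminf e lam N F = Mminf e lam N F)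
     \<and> (\<forall>\<A>. global_attractor (flow e lam F) \<A> \<longrightarrow> \<A> \<subseteq> Mminf e lam N F)"
proof -
  have "0 < lam n" for n
    using lam_pos monoD[OF lam_mono, of 0 n] by simp
  then interpret semilinear e lam F K0 K1
    using assms by unfold_locales auto
  show ?thesis
    using Phi_nonempty upper_hemicontinuous_Phi Mminf_eq_graph Mminf_invariant
      bounded_invariant_subset_Mminf
    unfolding global_attractor_def
    by (auto simp: compact_imp_bounded)
qed

end
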